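(* Let $\Omega\subset\mathbb{R}^d$ be open and bounded, $Y$ a real Hilbert space, $y\in Y$, $m\in\{0,1\}$, $c>0$, $\lambda=1/c$. Let $A:L^1(\Omega)\to Y$ be a bounded linear operator such that, for some $\gamma>0$, $$\|Au-Av\|\le\gamma\sqrt{d(u,v)}\quad\text{for all }u,v\in\mathrm{dom}(f+\chi_m),$$ and such that $D(u,v)\ge0$ for all $u\in\mathrm{dom}(f+\chi_m)$ and $v\in\mathrm{dom}(f+\chi_m)\cap\mathrm{dom}\,\partial f$. Assume that $Au=y$ has a positive solution $z\in\mathrm{dom}\,f$, with $\chi_m(z)=0$ if $m=1$. For each noise level $\delta>0$ let $y^\delta\in Y$ be noisy data with $\|y-y^\delta\|\le\delta$. Let $u_0\in\mathrm{dom}\,\partial f$ be an arbitrary starting element (independent of $\delta$) with $1+\ln u_0\in\mathcal{R}(A^* )$ and, if $m=1$, $\chi_m(u_0)=0$. For each $\delta$ let $\{u_k\}_{k\in\mathbb{N}}$ (depending on $\delta$) be the iterates $$u_{k+1}\in\arg\min_{u\in\mathrm{dom}\,f}\left\{\langle Au-y^\delta,Au_k-y^\delta\rangle+c\,d(u,u_k)+\chi_m(u)\right\},\quad k=0,1,2,\dots$$ Then: (i) The residual $\|Au_k-y^\delta\|$ decreases monotonically (is nonincreasing in $k$), and $$\tfrac12\|y^\delta-Au_{k+1}\|^2+D(z,u_{k+1})+D(u_{k+1},u_k)\le\tfrac{\delta^2}{2}+D(z,u_k),\qquad k\in\mathbb{N}=\{0,1,2,\dots\},$$ $$\|y^\delta-Au_k\|^2\le\delta^2+\frac{2D(z,u_0)}{k},\qquad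 k\ge1.$$ (ii) The term $D(z,u_k)$ decreases as long as $\|y^\delta-Au_k\|^2>\delta^2$; that is, $D(z,u_k)<D(z,u_{k-1})$ for every $k\ge1$ with $\|y^\delta-Au_k\|^2>\delta^2$. (iii) For every $\tau>1$, the index $$k_*(\delta)=\min\{k\in\mathbb{N}:\|Au_k-y^\delta\|<\sqrt{\tau}\,\delta\}$$ is finite (i.e. the set is nonempty). (iv) For every $\tau>1$, the family $\{u_{k_*(\delta)}\}_{\delta}$ has a weakly convergent subsequence in $L^1(\Omega)$ as $\delta\to0$ (i.e. along some sequence $\delta_n\to0$). If $\{k_*(\delta)\}_\delta$ is unbounded, then each limit point (weak limit in $L^1(\Omega)$ of such a subsequence) is a solution of $Au=y$.
   Context: $f:L^1(\Omega)\to(-\infty,+\infty]$ is the negative Boltzmann-Shannon entropy: $f(u)=\int_\Omega u(t)\ln u(t)\,dt$ if $u\ge 0$ a.e. and $u\ln u\in L^1(\Omega)$, and $f(u)=+\infty$ otherwise (with $0\ln 0=0$). $\mathrm{dom}\,f=\{u\in L^1(\Omega): f(u)<\infty\}$. $\mathrm{dom}\,\partial f$ denotes the set of $u\in L^1(\Omega)$ that are (nonnegative,) essentially bounded and bounded away from zero a.e., i.e. $0<\alpha\le u\le\beta<\infty$ a.e. for some constants $\alpha,\beta$. For $v,u\in\mathrm{dom}\,f$ the Kullback-Leibler divergence is $d(v,u)=\int_\Omega\big[v(t)\ln\frac{v(t)}{u(t)}-v(t)+u(t)\big]dt\in[0,+\infty]$ (with $0\ln\frac{0}{s}=0$ for $s\ge0$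 and $s\ln\frac{s}{0}=+\infty$ for $s>0$). $\chi_0\equiv 0$; $\chi_1(u)=0$ if $\int_\Omega u(t)\,dt=1$ and $\chi_1(u)=+\infty$ otherwise; $\mathrm{dom}(f+\chi_m)=\{u: f(u)+\chi_m(u)<\infty\}$. $D(u,v)=c\,d(u,v)-\frac12\|Au-Av\|^2$. $A^*:Y\to L^\infty(\Omega)$ is the adjoint of $A$ (identifying $Y^*$ with $Y$) and $\mathcal{R}(A^* )$ its range. (The nonnegativity of $D$ holds e.g. if $c\ge\gamma^2/2$.) The minimizer in each step exists, is unique, lies in $\mathrm{dom}\,\partial f$, and equals $u_{k+1}=u_k c_k^m e^{\lambda A^*(y^\delta-Au_k)}$ with $c_k^0=1$ and $c_k^1=1/\int_\Omega u_k e^{\lambda A^*(y^\delta-Au_k)}dt$. *)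

theory Defs
  imports "HOL-Analysis.Analysis"
begin

text \<open>
  Elements of \<open>L\<^sup>1(\<Omega>)\<close> and \<open>L\<^sup>\<infinity>(\<Omega>)\<close> are represented by functions on the whole space that are
  regarded up to equality almost everywhere on \<open>\<Omega>\<close>; all notions below are invariant under
  changes on null sets.
\<close>

definition L1 :: "'a::euclidean_space set \<Rightarrow> ('a \<Rightarrow> real) set" where
  "L1 \<Omega> = {u. integrable (lebesgue_on \<Omega>) u}"

definition Linf :: "'a::euclidean_space set \<Rightarrow> ('a \<Rightarrow> real) set" where
  "Linf \<Omega> = {g \<in> borel_measurable (lebesgue_on \<Omega>). \<exists>C. AE t in lebesgue_on \<Omega>. \<bar>g t\<bar> \<le> C}"

definition bounded_linear_L1 ::
  "'a::euclidean_space set \<Rightarrow> (('a \<Rightarrow> real) \<Rightarrow> 'b::real_normed_vector) \<Rightarrow> bool" where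
  "bounded_linear_L1 \<Omega> A \<longleftrightarrow>
     (\<forall>u\<in>L1 \<Omega>. \<forall>v\<in>L1 \<Omega>. A (\<lambda>t. u t + v t) = A u + A v) \<and>
     (\<forall>r. \<forall>u\<in>L1 \<Omega>. A (\<lambda>t. r * u t) = r *\<^sub>R A u) \<and>
     (\<exists>K. \<forall>u\<in>L1 \<Omega>. norm (A u) \<le> K * (LINT t|lebesgue_on \<Omega>. \<bar>u t\<bar>))"

text \<open>The norm bound makes such an operator well defined on equivalence classes.\<close>

lemma bounded_linear_L1_cong_AE:
  assumes A: "bounded_linear_L1 \<Omega> A" and u: "u \<in> L1 \<Omega>" and v: "v \<in> L1 \<Omega>"
    and eq: "AE t in lebesgue_on \<Omega>. u t = v t"
  shows "A u = A v"
proof -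
  define w where "w = (\<lambda>t. (-1) * v t)"
  have w: "w \<in> L1 \<Omega>" using v by (simp add: L1_def w_def)
  have uw: "(\<lambda>t. u t + w t) \<in> L1 \<Omega>" using u w by (simp add: L1_def)
  obtain K where K: "\<And>x. x \<in> L1 \<Omega> \<Longrightarrow> norm (A x) \<le> K * (LINT t|lebesgue_on \<Omega>. \<bar>x t\<bar>)"
    using A unfolding bounded_linear_L1_def by blast
  have "AE t in lebesgue_on \<Omega>. \<bar>u t + w t\<bar> = 0"
    using eq by (auto simp: w_def)
  then have "(LINT t|lebesgue_on \<Omega>. \<bar>u t + w t\<bar>) = 0"
    by (rule integral_eq_zero_AE)
  then have "A (\<lambda>t. u t + w t) = 0" using K[OF uw] by simp
  moreover have "A (\<lambda>t. u t + w t) = A u + A w"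
    using A u w unfolding bounded_linear_L1_def by blast
  moreover have "A w = (-1) *\<^sub>R A v"
    using A v unfolding bounded_linear_L1_def w_def by blast
  ultimately show ?thesis by simp
qed

text \<open>Weak convergence, tested against the whole dual space of \<open>L\<^sup>1(\<Omega>)\<close>.\<close>

definition weakly_converges_L1 ::
  "'a::euclidean_space set \<Rightarrow> (nat \<Rightarrow> 'a \<Rightarrow> real) \<Rightarrow> ('a \<Rightarrow> real) \<Rightarrow> bool" where
  "weakly_converges_L1 \<Omega> x v \<longleftrightarrow>
     (\<forall>n. x n \<in> L1 \<Omega>) \<and> v \<in> L1 \<Omega> \<and>
     (\<forall>\<phi> :: ('a \<Rightarrow> real) \<Rightarrow> real. bounded_linear_L1 \<Omega> \<phi> \<longrightarrow> (\<lambda>n. \<phi> (x n)) \<longlonglongrightarrow> \<phi> v)"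

text \<open>\<open>adjoint_value \<Omega> A w g\<close>: the function \<open>g\<close> represents \<open>A\<^sup>* w \<in> L\<^sup>\<infinity>(\<Omega>)\<close>.\<close>

definition adjoint_value ::
  "'a::euclidean_space set \<Rightarrow> (('a \<Rightarrow> real) \<Rightarrow> 'y::real_inner) \<Rightarrow> 'y \<Rightarrow> ('a \<Rightarrow> real) \<Rightarrow> bool" where
  "adjoint_value \<Omega> A w g \<longleftrightarrow>
     g \<in> Linf \<Omega> \<and> (\<forall>u\<in>L1 \<Omega>. inner (A u) w = (LINT t|lebesgue_on \<Omega>. u t * g t))"

definition range_adjoint ::
  "'a::euclidean_space set \<Rightarrow> (('a \<Rightarrow> real) \<Rightarrow> 'y::real_inner) \<Rightarrow> ('a \<Rightarrow> real) set" where
  "range_adjoint \<Omega> A = {g. \<exists>w. adjoint_value \<Omega> A w g}"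

text \<open>Negative Boltzmann--Shannon entropy. The convention \<open>0 ln 0 = 0\<close> holds since \<open>0 * x = 0\<close>.\<close>

definition entropy :: "'a::euclidean_space set \<Rightarrow> ('a \<Rightarrow> real) \<Rightarrow> ereal" where
  "entropy \<Omega> u =
     (if (AE t in lebesgue_on \<Omega>. 0 \<le> u t) \<and> integrable (lebesgue_on \<Omega>) (\<lambda>t. u t * ln (u t))
      then ereal (LINT t|lebesgue_on \<Omega>. u t * ln (u t)) else \<infinity>)"

definition chi :: "'a::euclidean_space set \<Rightarrow> nat \<Rightarrow> ('a \<Rightarrow> real) \<Rightarrow> ereal" where
  "chi \<Omega> m u = (if m = 0 then 0 else if (LINT t|lebesgue_on \<Omega>. u t) = 1 then 0 else \<infinity>)"

definition dom_entropy :: "'a::euclidean_space set \<Rightarrow> ('a \<Rightarrow> real) set" where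
  "dom_entropy \<Omega> = {u \<in> L1 \<Omega>. entropy \<Omega> u < \<infinity>}"

definition dom_entropy_chi :: "'a::euclidean_space set \<Rightarrow> nat \<Rightarrow> ('a \<Rightarrow> real) set" where
  "dom_entropy_chi \<Omega> m = {u \<in> L1 \<Omega>. entropy \<Omega> u + chi \<Omega> m u < \<infinity>}"

text \<open>The domain of the subdifferential of the entropy.\<close>

definition dom_subdiff_entropy :: "'a::euclidean_space set \<Rightarrow> ('a \<Rightarrow> real) set" where
  "dom_subdiff_entropy \<Omega> =
     {u \<in> L1 \<Omega>. \<exists>\<alpha> \<beta>. 0 < \<alpha> \<and> (AE t in lebesgue_on \<Omega>. \<alpha> \<le> u t \<and> u t \<le> \<beta>)}"

text \<open>
  \<open>s ln (s / r)\<close> for \<open>s, r \<ge> 0\<close>, with \<open>0 ln (0 / r) = 0\<close> and \<open>s ln (s / 0) = \<infinity>\<close> for \<open>s > 0\<close>.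
\<close>

definition log_ratio_term :: "real \<Rightarrow> real \<Rightarrow> ereal" where
  "log_ratio_term s r = (if s = 0 then 0 else if r = 0 then \<infinity> else ereal (s * ln (s / r)))"

text \<open>
  Kullback--Leibler divergence. For \<open>v, u \<ge> 0\<close> the integrand is nonnegative, so that its
  integral in \<open>[0, \<infinity>]\<close> is the nonnegative Lebesgue integral.
\<close>

definition KL :: "'a::euclidean_space set \<Rightarrow> ('a \<Rightarrow> real) \<Rightarrow> ('a \<Rightarrow> real) \<Rightarrow> ereal" where
  "KL \<Omega> v u =
     enn2ereal (\<integral>\<^sup>+ t. e2ennreal (log_ratio_term (v t) (u t) - ereal (v t) + ereal (u t))
       \<partial>lebesgue_on \<Omega>)"

definition Dfun ::
  "'a::euclidean_space set \<Rightarrow> (('a \<Rightarrow> real) \<Rightarrow> 'y::real_inner) \<Rightarrow> real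
    \<Rightarrow> ('a \<Rightarrow> real) \<Rightarrow> ('a \<Rightarrow> real) \<Rightarrow> ereal" where
  "Dfun \<Omega> A c u v = ereal c * KL \<Omega> u v - ereal (1/2 * (norm (A u - A v))\<^sup>2)"

definition step_functional ::
  "'a::euclidean_space set \<Rightarrow> (('a \<Rightarrow> real) \<Rightarrow> 'y::real_inner) \<Rightarrow> real \<Rightarrow> nat \<Rightarrow> 'y
    \<Rightarrow> ('a \<Rightarrow> real) \<Rightarrow> ('a \<Rightarrow> real) \<Rightarrow> ereal" where
  "step_functional \<Omega> A c m yd uk u =
     ereal (inner (A u - yd) (A uk - yd)) + ereal c * KL \<Omega> u uk + chi \<Omega> m u"

definition stopping_index ::
  "(('a \<Rightarrow> real) \<Rightarrow> 'y::real_inner) \<Rightarrow> real \<Rightarrow> real \<Rightarrow> 'y \<Rightarrow> (nat \<Rightarrow> 'a \<Rightarrow> real) \<Rightarrow> nat" where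
  "stopping_index A \<tau> \<delta> yd u = (LEAST k. norm (A (u k) - yd) < sqrt \<tau> * \<delta>)"

end

theory Submission
  imports Defs "HOL-Complex_Analysis.Great_Picard"
begin

text \<open>
  Representing \<open>A\<^sup>*(y\<^sup>\<delta> - A u\<^sub>k)\<close> by a bounded function turns the objective of a step into
  \<open>c d(w, v)\<close> plus a constant, where \<open>v = u\<^sub>k e\<^sup>\<dots>\<close> is the explicit multiplicative update; hence
  \<open>u\<^sub>k\<^sub>+\<^sub>1 = v\<close> almost everywhere, and a three-point identity holds, from which the descent and
  residual estimates follow. Moreover \<open>1 + ln u\<^sub>k\<close> stays, up to a constant, in the range of \<open>A\<^sup>*\<close>,
  with a source element that accumulates the residuals and is of order \<open>1 / \<delta>\<close> at the stopping
  index. Since the residual there is of order \<open>\<delta>\<close>, the entropy of the stopped iterates is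
  bounded, which gives uniform integrability and therefore weak sequential compactness in
  \<open>L\<^sup>1\<close> (Dunford--Pettis).
\<close>

section \<open>The dual of \<open>L\<^sup>1\<close>\<close>

text \<open>Boundedness of D(z, u_k) alone would not give compactness: for fixed z the divergence
  d(z, u) grows only linearly in u, so it controls the norm in L1 but permits concentration on small
  sets. The entropy of the iterates has to be bounded instead, and this is what the source condition
  on 1 + ln u_0 is for. Convexity of f gives f(u_k) <= f(z) - <A z - A u_k, w_k> with w_k the source
  element of u_k; at the stopping index the first factor is O(\<delta>) and the second
  O(1/\<delta>). When m = 1 the normalising factor adds to ln u_k a constant that need not lie in
  the range of the adjoint; it disappears because z - u_k has integral zero.

  The duality of L1 with essentially bounded functions enters twice: to represent adjoint values by
  functions, and to pass from bounded test functions to all functionals in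
  \<open>weakly_converges_L1\<close>. Both this duality and the existence of weak limits rest on the
  lemma below, a Radon-Nikodym theorem for charges that are assumed only finitely additive.\<close>

lemma density_of_absolutely_continuous_charge:
  fixes \<nu> :: "'a set \<Rightarrow> real"
  assumes M: "finite_measure M"
    and nonneg: "\<And>E. E \<in> sets M \<Longrightarrow> 0 \<le> \<nu> E"
    and add: "\<And>E F. E \<in> sets M \<Longrightarrow> F \<in> sets M \<Longrightarrow> E \<inter> F = {} \<Longrightarrow> \<nu> (E \<union> F) = \<nu> E + \<nu> F"
    and ac: "\<And>e. 0 < e \<Longrightarrow> \<exists>d>0. \<forall>E\<in>sets M. measure M E < d \<longrightarrow> \<nu> E \<le> e"
  obtains f where "integrable M f" "\<And>t. 0 \<le> f t"
    "\<And>E. E \<in> sets M \<Longrightarrow> \<nu> E = (LINT t|M. indicator E t * f t)"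
proof -
  interpret finite_measure M by fact
  \<comment> \<open>Countable additivity is recovered from continuity at the empty set: on sets
    decreasing to it the finite measure tends to 0, and absolute continuity carries this over to
    \<open>\<nu>\<close>. So \<open>N\<close> is a measure and Radon-Nikodym applies.\<close>
  define N where "N = measure_of (space M) (sets M) (\<lambda>E. ennreal (\<nu> E))"
  have empty: "\<nu> {} = 0" using add[of "{}" "{}"] by simp
  have pos: "positive (sets M) (\<lambda>E. ennreal (\<nu> E))"
    by (simp add: positive_def empty)
  have addit: "additive (sets M) (\<lambda>E. ennreal (\<nu> E))"
    by (auto simp: additive_def add nonneg ennreal_plus)
  have ca: "countably_additive (sets M) (\<lambda>E. ennreal (\<nu> E))"
  proof (rule sets.empty_continuous_imp_countably_additive[OF pos addit])
    fix S :: "nat \<Rightarrow> 'a set"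
    assume S: "range S \<subseteq> sets M" "decseq S" "(\<Inter>i. S i) = {}"
    have lim: "(\<lambda>i. measure M (S i)) \<longlonglongrightarrow> 0"
      using finite_Lim_measure_decseq[OF S(1,2)] S(3) by simp
    have "(\<lambda>i. \<nu> (S i)) \<longlonglongrightarrow> 0"
    proof (rule LIMSEQ_I)
      fix r :: real assume "0 < r"
      then obtain d where d: "d > 0" "\<And>E. E \<in> sets M \<Longrightarrow> measure M E < d \<Longrightarrow> \<nu> E \<le> r / 2"
        using ac[of "r / 2"] by auto
      obtain n0 where "\<And>n. n \<ge> n0 \<Longrightarrow> norm (measure M (S n) - 0) < d"
        using LIMSEQ_D[OF lim d(1)] by auto
      then have "\<nu> (S n) \<le> r / 2" if "n \<ge> n0" for n
        using that d(2)[of "S n"] S(1) by auto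
      moreover have "0 \<le> \<nu> (S n)" for n using nonneg S(1) by auto
      ultimately show "\<exists>n0. \<forall>n\<ge>n0. norm (\<nu> (S n) - 0) < r"
        using \<open>0 < r\<close> by (intro exI[of _ n0]) fastforce
    qed
    then show "(\<lambda>i. ennreal (\<nu> (S i))) \<longlonglongrightarrow> 0"
      using tendsto_ennrealI by fastforce
  qed auto
  have sN [simp]: "sets N = sets M" "space N = space M"
    by (simp_all add: N_def sets.sets_into_space)
  have eN: "emeasure N E = ennreal (\<nu> E)" if "E \<in> sets M" for E
    unfolding N_def using that pos ca
    by (intro emeasure_measure_of_sigma) (auto simp: sets.sigma_algebra_axioms)
  have fN: "finite_measure N"
    by (intro finite_measureI) (simp add: eN)
  have "absolutely_continuous M N"
    unfolding absolutely_continuous_def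
  proof
    fix E assume "E \<in> null_sets M"
    then have E: "E \<in> sets M" "measure M E = 0" by (auto simp: measure_def)
    have "\<nu> E \<le> 0 + e" if "0 < e" for e
      using ac[OF that] E by auto
    then have "\<nu> E \<le> 0" by (rule field_le_epsilon)
    then show "E \<in> null_sets N" using E(1) by (auto simp: null_sets_def eN ennreal_eq_0_iff)
  qed
  then obtain h where h[measurable]: "h \<in> borel_measurable M" and hN: "density M h = N"
    using Radon_Nikodym_finite_measure[OF fN] by auto
  have nn: "(\<integral>\<^sup>+t. h t * indicator E t \<partial>M) = ennreal (\<nu> E)" if "E \<in> sets M" for E
    using emeasure_density[OF h that] by (simp add: hN eN that)
  have "(\<integral>\<^sup>+t. h t \<partial>M) = ennreal (\<nu> (space M))"
    using nn[OF sets.top] by (simp cong: nn_integral_cong)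
  then have fin: "AE t in M. h t \<noteq> \<infinity>"
    by (intro nn_integral_PInf_AE) auto
  define f where "f = (\<lambda>t. enn2real (h t))"
  have f[measurable]: "f \<in> borel_measurable M" unfolding f_def by simp
  have nnf: "(\<integral>\<^sup>+t. ennreal (indicator E t * f t) \<partial>M) = ennreal (\<nu> E)" if "E \<in> sets M" for E
  proof -
    have "(\<integral>\<^sup>+t. ennreal (indicator E t * f t) \<partial>M) = (\<integral>\<^sup>+t. h t * indicator E t \<partial>M)"
      using fin
      by (intro nn_integral_cong_AE, elim AE_mp)
        (auto simp: f_def indicator_def top.not_eq_extremum)
    then show ?thesis using nn[OF that] by simp
  qed
  have f0: "0 \<le> f t" for t by (simp add: f_def)
  have "(\<integral>\<^sup>+t. ennreal (f t) \<partial>M) = ennreal (\<nu> (space M))"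
    using nnf[OF sets.top] by (simp cong: nn_integral_cong)
  then have "integrable M f"
    by (intro integrableI_nonneg) (auto simp: f0)
  moreover have "\<nu> E = (LINT t|M. indicator E t * f t)" if E: "E \<in> sets M" for E
  proof -
    have "(LINT t|M. indicator E t * f t) = enn2real (ennreal (\<nu> E))"
      using E by (subst integral_eq_nn_integral) (auto simp: f0 nnf)
    then show ?thesis by (simp add: nonneg E)
  qed
  ultimately show ?thesis using that f0 by blast
qed

text \<open>On indicators \<open>\<phi>\<close> is a signed charge dominated by a multiple of the
  measure, so it has an essentially bounded density. The density represents \<open>\<phi>\<close> on
  indicators, hence everywhere by linearity and continuity.\<close>

lemma bounded_functional_on_integrable_repr:
  fixes \<phi> :: "('a \<Rightarrow> real) \<Rightarrow> real"
  assumes M: "finite_measure M"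
    and add: "\<And>u v. integrable M u \<Longrightarrow> integrable M v \<Longrightarrow> \<phi> (\<lambda>t. u t + v t) = \<phi> u + \<phi> v"
    and scale: "\<And>r u. integrable M u \<Longrightarrow> \<phi> (\<lambda>t. r * u t) = r * \<phi> u"
    and bound: "\<And>u. integrable M u \<Longrightarrow> \<bar>\<phi> u\<bar> \<le> K * (LINT t|M. \<bar>u t\<bar>)"
  obtains g C where "g \<in> borel_measurable M" "AE t in M. \<bar>g t\<bar> \<le> C"
    "\<And>u. integrable M u \<Longrightarrow> \<phi> u = (LINT t|M. u t * g t)"
proof -
  interpret finite_measure M by fact
  define L where "L = \<bar>K\<bar> + 1"
  have L: "0 < L" "K \<le> L" by (auto simp: L_def)
  have bound: "\<bar>\<phi> u\<bar> \<le> L * (LINT t|M. \<bar>u t\<bar>)" if "integrable M u" for u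
    using bound[OF that] mult_right_mono[OF L(2), of "LINT t|M. \<bar>u t\<bar>"] by simp
  have ind: "integrable M (indicat_real E)" if "E \<in> sets M" for E
    using that emeasure_finite[of E] by (simp add: less_top[symmetric])
  \<comment> \<open>The shift by \<open>L\<close> times the measure makes the charge of \<open>\<phi>\<close> nonnegative.\<close>
  define \<nu> where "\<nu> E = \<phi> (indicator E) + L * measure M E" for E
  have bi: "\<bar>\<phi> (indicator E)\<bar> \<le> L * measure M E" if "E \<in> sets M" for E
    using bound[OF ind[OF that]] that by simp
  have \<nu>_le: "\<nu> E \<le> 2 * L * measure M E" if "E \<in> sets M" for E
    using bi[OF that] by (simp add: \<nu>_def)
  obtain f where f: "integrable M f" "\<And>t. 0 \<le> f t"
    "\<And>E. E \<in> sets M \<Longrightarrow> \<nu> E = (LINT t|M. indicator E t * f t)"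
  proof (rule density_of_absolutely_continuous_charge[OF M, of \<nu>])
    show "0 \<le> \<nu> E" if "E \<in> sets M" for E
      using bi[OF that] by (simp add: \<nu>_def)
    show "\<nu> (E \<union> F) = \<nu> E + \<nu> F" if "E \<in> sets M" "F \<in> sets M" "E \<inter> F = {}" for E F
    proof -
      have "indicator (E \<union> F) = (\<lambda>t. indicat_real E t + indicator F t)"
        using that(3) by (auto simp: indicator_def fun_eq_iff)
      then show ?thesis
        using that by (simp add: \<nu>_def add ind finite_measure_Union distrib_left)
    qed
    show "\<exists>d>0. \<forall>E\<in>sets M. measure M E < d \<longrightarrow> \<nu> E \<le> e" if "0 < e" for e
    proof (intro exI[of _ "e / (2 * L)"] conjI ballI impI)
      fix E assume E: "E \<in> sets M" "measure M E < e / (2 * L)"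
      then have "2 * L * measure M E < e" using L by (simp add: field_simps)
      then show "\<nu> E \<le> e" using \<nu>_le[OF E(1)] by linarith
    qed (use L that in simp)
  qed (rule that)
  have f_le: "AE t in M. f t \<le> 2 * L"
  proof -
    \<comment> \<open>Over this superlevel set the nonnegative function \<open>f t - 2 * L\<close>
      has integral at most 0 by \<open>\<nu>_le\<close>, so the set is null.\<close>
    define E where "E = {t \<in> space M. 2 * L < f t}"
    have [measurable]: "f \<in> borel_measurable M" using f(1) by auto
    have E: "E \<in> sets M" unfolding E_def by measurable
    have int: "integrable M (\<lambda>t. indicator E t * (f t - 2 * L))"
      using E f(1) integrable_mult_indicator[OF E, of "\<lambda>t. f t - 2 * L"] by simp
    have "(LINT t|M. indicator E t * (f t - 2 * L)) = \<nu> E - 2 * L * measure M E"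
      using integrable_mult_indicator[OF E f(1)] ind[OF E] E
      by (simp add: right_diff_distrib f(3))
    also have "\<dots> \<le> 0" using \<nu>_le[OF E] by simp
    finally have "(LINT t|M. indicator E t * (f t - 2 * L)) = 0"
      by (intro antisym integral_nonneg_AE) (auto simp: E_def indicator_def)
    moreover have "AE t in M. 0 \<le> indicator E t * (f t - 2 * L)"
      by (auto simp: E_def indicator_def)
    ultimately have "AE t in M. indicator E t * (f t - 2 * L) = 0"
      using integral_nonneg_eq_0_iff_AE[OF int] by simp
    then show ?thesis
      by (elim AE_mp) (auto simp: E_def indicator_def split: if_splits)
  qed
  \<comment> \<open>Subtracting \<open>L\<close> undoes the shift, and the bounds 0 and
    \<open>2 * L\<close> for \<open>f\<close> become \<open>L\<close> for the absolute value of
    \<open>g\<close>.\<close>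
  define g where "g = (\<lambda>t. f t - L)"
  have g[measurable]: "g \<in> borel_measurable M" using f(1) unfolding g_def by auto
  have g_le: "AE t in M. \<bar>g t\<bar> \<le> L"
    using f_le by (elim AE_mp) (use f(2) in \<open>auto simp: g_def abs_le_iff\<close>)
  have int_g: "integrable M (\<lambda>t. u t * g t)" if u: "integrable M u" for u
  proof (rule Bochner_Integration.integrable_bound)
    show "integrable M (\<lambda>t. L * u t)" using u by simp
    show "(\<lambda>t. u t * g t) \<in> borel_measurable M" using u by auto
    show "AE t in M. norm (u t * g t) \<le> norm (L * u t)"
      using g_le by (elim AE_mp) (use L in \<open>auto intro!: mult_right_mono simp: abs_mult mult.commute\<close>)
  qed
  have "\<phi> u = (LINT t|M. u t * g t)" if "integrable M u" for u
    using that
  proof (induct u rule: integrable_induct)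
    case (base E r)
    have "\<phi> (indicator E) = (LINT t|M. indicator E t * g t)"
      using f(3)[OF base(1)] integrable_mult_indicator[OF base(1) f(1)] base
      by (simp add: g_def right_diff_distrib \<nu>_def algebra_simps)
    then show ?case
      using scale[OF ind[OF base(1)], of r] integral_mult_right_zero[of M r "\<lambda>t. indicator E t * g t"]
      by (simp add: mult_ac)
  next
    case (add u v)
    then show ?case using assms(2) int_g by (simp add: distrib_right)
  next
    case (lim u s)
    have [measurable]: "u \<in> borel_measurable M" "\<And>i. s i \<in> borel_measurable M"
      using lim(1,5) by (simp_all add: borel_measurable_integrable)
    have neg: "integrable M (\<lambda>t. -1 * u t)" using lim(5) by simp
    have eq: "\<phi> (s i) - \<phi> u = \<phi> (\<lambda>t. s i t - u t)" for i
      using assms(2)[OF lim(1)[of i] neg] scale[OF lim(5), of "-1"] by simp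
    \<comment> \<open>The simple functions supplied by \<open>integrable_induct\<close> satisfy
      |s_i| <= 2|u|, whence the dominating function 3|u|.\<close>
    have "(\<lambda>i. LINT t|M. \<bar>s i t - u t\<bar>) \<longlonglongrightarrow> (LINT t|M. 0)"
    proof (rule integral_dominated_convergence[where w = "\<lambda>t. 3 * \<bar>u t\<bar>"])
      show "AE t in M. (\<lambda>i. \<bar>s i t - u t\<bar>) \<longlonglongrightarrow> 0"
        using lim(3) by (auto intro!: tendsto_rabs_zero LIM_zero)
      show "AE t in M. norm \<bar>s i t - u t\<bar> \<le> 3 * \<bar>u t\<bar>" for i
        using lim(4)[of _ i] by (intro AE_I2) (fastforce intro: abs_triangle_ineq4[THEN order_trans])
    qed (use lim in auto)
    then have 0: "(\<lambda>i. LINT t|M. \<bar>s i t - u t\<bar>) \<longlonglongrightarrow> 0" by simp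
    have "norm (\<phi> (s i) - \<phi> u) \<le> L * (LINT t|M. \<bar>s i t - u t\<bar>)" for i
      unfolding eq real_norm_def using lim(1,5) by (intro bound) auto
    then have "(\<lambda>i. \<phi> (s i) - \<phi> u) \<longlonglongrightarrow> 0"
      by (intro Lim_null_comparison[OF always_eventually tendsto_mult_right_zero[OF 0, of L]]) auto
    then have l1: "(\<lambda>i. \<phi> (s i)) \<longlonglongrightarrow> \<phi> u" by (simp add: LIM_zero_iff)
    have "(\<lambda>i. LINT t|M. s i t * g t) \<longlonglongrightarrow> (LINT t|M. u t * g t)"
    proof (rule integral_dominated_convergence[where w = "\<lambda>t. 2 * L * \<bar>u t\<bar>"])
      show "AE t in M. (\<lambda>i. s i t * g t) \<longlonglongrightarrow> u t * g t"
        using lim(3) by (auto intro!: tendsto_intros)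
      show "AE t in M. norm (s i t * g t) \<le> 2 * L * \<bar>u t\<bar>" for i
        using g_le
      proof (elim AE_mp, intro AE_I2 impI)
        fix t assume t: "t \<in> space M" "\<bar>g t\<bar> \<le> L"
        have "\<bar>s i t\<bar> * \<bar>g t\<bar> \<le> (2 * \<bar>u t\<bar>) * L"
          using lim(4)[OF t(1), of i] t(2) by (intro mult_mono) auto
        then show "norm (s i t * g t) \<le> 2 * L * \<bar>u t\<bar>" by (simp add: abs_mult mult_ac)
      qed
    qed (use lim in auto)
    then show ?case using l1 lim(2) LIMSEQ_unique by auto
  qed
  then show ?thesis using that g g_le by blast
qed

section \<open>Weak compactness in \<open>L\<^sup>1\<close>\<close>

text \<open>The family consists of the finite unions of basic open sets. Outer regularity replaces
  \<open>E\<close> by an open superset of slightly larger measure, and finite partial unions exhaust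
  that open set up to a small remainder. Countability is what allows a diagonal extraction
  later.\<close>

lemma lebesgue_on_countable_dense_sets:
  fixes \<Omega> :: "'a::euclidean_space set"
  assumes \<Omega>: "\<Omega> \<in> lmeasurable"
  obtains F where "countable F" "F \<subseteq> sets (lebesgue_on \<Omega>)"
    "\<And>E e. E \<in> sets (lebesgue_on \<Omega>) \<Longrightarrow> 0 < e \<Longrightarrow>
      \<exists>E'\<in>F. measure (lebesgue_on \<Omega>) ((E - E') \<union> (E' - E)) < e"
proof -
  obtain B :: "'a set set" where B: "countable B" "topological_basis B"
    using ex_countable_basis by blast
  have op: "open b" if "b \<in> B" for b using B(2) that by (rule topological_basis_open)
  have \<Omega>s: "\<Omega> \<in> sets lebesgue" using \<Omega> by auto
  interpret finite_measure "lebesgue_on \<Omega>" using \<Omega> by (rule finite_measure_lebesgue_on)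
  define F where "F = (\<lambda>X. \<Omega> \<inter> \<Union>X) ` {X. X \<subseteq> B \<and> finite X}"
  have sets_op: "\<Omega> \<inter> T \<in> sets (lebesgue_on \<Omega>)" if "open T" for T
    using that by (auto simp: sets_restrict_space)
  have cF: "countable F"
    unfolding F_def using countable_Collect_finite_subset[OF B(1)] by (simp add: conj_commute)
  moreover have sF: "F \<subseteq> sets (lebesgue_on \<Omega>)"
    unfolding F_def using op by (force intro!: sets_op)
  moreover have "\<exists>E'\<in>F. measure (lebesgue_on \<Omega>) ((E - E') \<union> (E' - E)) < e"
    if E: "E \<in> sets (lebesgue_on \<Omega>)" and e: "0 < e" for E e
  proof -
    have E': "E \<in> sets lebesgue" "E \<subseteq> \<Omega>"
      using E \<Omega>s by (auto simp: sets_restrict_space_iff)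
    obtain T where T: "open T" "E \<subseteq> T" "T - E \<in> lmeasurable" "emeasure lebesgue (T - E) < ennreal (e / 2)"
      using sets_lebesgue_outer_open[OF E'(1), of "e / 2"] e by auto
    then have TE: "measure lebesgue (T - E) < e / 2"
      using e by (metis emeasure_eq_measure2 ennreal_less_iff measure_nonneg)
    obtain B' where B': "B' \<subseteq> B" "T = \<Union>B'"
      using B(2) T(1) unfolding topological_basis_def by blast
    have cB': "countable B'" using B' B(1) countable_subset by blast
    \<comment> \<open>\<open>from_nat_into\<close> enumerates only nonempty sets, and B' may be
      empty when the open set T is.\<close>
    define X where "X i = (if B' = {} then {} else from_nat_into B' ` {..i})" for i :: nat
    define S where "S i = \<Omega> \<inter> \<Union>(X i)" for i :: nat
    have "X i \<subseteq> B'" "finite (X i)" for i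
      by (auto simp: X_def intro: from_nat_into)
    then have SF: "S i \<in> F" for i
      unfolding F_def S_def using B'(1) by blast
    have US: "(\<Union>i. S i) = \<Omega> \<inter> T"
    proof (cases "B' = {}")
      case False
      then have "range (from_nat_into B') = B'" using cB' by (rule range_from_nat_into)
      then have "T = (\<Union>i. from_nat_into B' i)" using B'(2) by simp
      then show ?thesis using False by (auto simp: S_def X_def)
    qed (auto simp: S_def X_def B')
    have "(\<lambda>i. measure (lebesgue_on \<Omega>) (S i)) \<longlonglongrightarrow> measure (lebesgue_on \<Omega>) (\<Union>i. S i)"
    proof (rule finite_Lim_measure_incseq)
      show "range S \<subseteq> sets (lebesgue_on \<Omega>)" using SF sF by auto
      show "incseq S" by (auto simp: incseq_def S_def X_def)
    qed
    then obtain i where i: "\<bar>measure (lebesgue_on \<Omega>) (S i) - measure (lebesgue_on \<Omega>) (\<Omega> \<inter> T)\<bar> < e / 2"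
      using LIMSEQ_D[of "\<lambda>i. measure (lebesgue_on \<Omega>) (S i)" _ "e / 2"] e unfolding US by auto
    have Si: "S i \<in> sets (lebesgue_on \<Omega>)" "S i \<subseteq> \<Omega> \<inter> T"
      using SF sF US by auto
    have Ts: "\<Omega> \<inter> T \<in> sets (lebesgue_on \<Omega>)" using T(1) by (rule sets_op)
    have ETs: "\<Omega> \<inter> T - E \<in> sets (lebesgue_on \<Omega>)" using Ts E by auto
    have "measure (lebesgue_on \<Omega>) (\<Omega> \<inter> T - E) = measure lebesgue (\<Omega> \<inter> T - E)"
      using \<Omega>s by (intro measure_restrict_space) auto
    also have "\<dots> \<le> measure lebesgue (T - E)"
      using T(3) ETs \<Omega>s by (intro measure_mono_fmeasurable) (auto simp: sets_restrict_space_iff)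
    finally have 1: "measure (lebesgue_on \<Omega>) (\<Omega> \<inter> T - E) < e / 2" using TE by simp
    have 2: "measure (lebesgue_on \<Omega>) (\<Omega> \<inter> T - S i) < e / 2"
      using finite_measure_Diff[OF Ts Si] i by linarith
    have "measure (lebesgue_on \<Omega>) ((E - S i) \<union> (S i - E))
        \<le> measure (lebesgue_on \<Omega>) ((\<Omega> \<inter> T - S i) \<union> (\<Omega> \<inter> T - E))"
      using Ts E Si E' T(2) by (intro finite_measure_mono) auto
    also have "\<dots> \<le> measure (lebesgue_on \<Omega>) (\<Omega> \<inter> T - S i) + measure (lebesgue_on \<Omega>) (\<Omega> \<inter> T - E)"
      using Ts E Si by (intro measure_Un_le) auto
    finally show ?thesis using 1 2 SF[of i] by (intro bexI[of _ "S i"]) auto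
  qed
  ultimately show ?thesis using that by blast
qed

lemma integrable_mult_AE_bounded:
  fixes u g :: "'a \<Rightarrow> real"
  assumes u: "integrable M u" and g: "g \<in> borel_measurable M" "AE t in M. \<bar>g t\<bar> \<le> C"
  shows "integrable M (\<lambda>t. u t * g t)"
proof (rule Bochner_Integration.integrable_bound)
  show "integrable M (\<lambda>t. C * u t)" using u by simp
  show "(\<lambda>t. u t * g t) \<in> borel_measurable M" using u g(1) by auto
  show "AE t in M. norm (u t * g t) \<le> norm (C * u t)"
    using g(2)
  proof (elim AE_mp, intro AE_I2 impI)
    fix t assume "\<bar>g t\<bar> \<le> C"
    then have "\<bar>g t\<bar> * \<bar>u t\<bar> \<le> \<bar>C\<bar> * \<bar>u t\<bar>" by (intro mult_right_mono) auto
    then show "norm (u t * g t) \<le> norm (C * u t)" by (simp add: abs_mult mult.commute)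
  qed
qed

text \<open>Rounding \<open>g\<close> down to integer multiples of \<open>e\<close> costs at most
  \<open>e\<close>, and boundedness leaves finitely many levels outside a null set.\<close>

lemma AE_bounded_uniform_step_approximation:
  fixes g :: "'a \<Rightarrow> real"
  assumes g[measurable]: "g \<in> borel_measurable M" and gC: "AE t in M. \<bar>g t\<bar> \<le> C" and e: "0 < e"
  obtains I :: "int set" and a :: "int \<Rightarrow> real" and E :: "int \<Rightarrow> 'a set"
  where "finite I" "\<And>i. E i \<in> sets M" "AE t in M. \<bar>g t - (\<Sum>i\<in>I. a i * indicator (E i) t)\<bar> \<le> e"
proof
  define N where "N = \<lceil>C / e\<rceil> + 1"
  define E where "E i = {t \<in> space M. \<lfloor>g t / e\<rfloor> = i}" for i
  show "finite {-N..N}" by simp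
  show "E i \<in> sets M" for i unfolding E_def by measurable
  show "AE t in M. \<bar>g t - (\<Sum>i\<in>{-N..N}. e * of_int i * indicator (E i) t)\<bar> \<le> e"
    using gC
  proof (elim AE_mp, intro AE_I2 impI)
    fix t assume t: "t \<in> space M" "\<bar>g t\<bar> \<le> C"
    define j where "j = \<lfloor>g t / e\<rfloor>"
    have "\<bar>g t / e\<bar> \<le> C / e" using t(2) e by (simp add: abs_divide divide_right_mono)
    then have j: "j \<in> {-N..N}" unfolding j_def N_def by (auto; linarith)
    have "(\<Sum>i\<in>{-N..N}. e * of_int i * indicator (E i) t) = (\<Sum>i\<in>{-N..N}. if i = j then e * of_int j else 0)"
      using t(1) by (intro sum.cong) (auto simp: E_def j_def indicator_def)
    also have "\<dots> = e * of_int j" using j by simp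
    finally have eq: "(\<Sum>i\<in>{-N..N}. e * of_int i * indicator (E i) t) = e * of_int j" .
    have "of_int j \<le> g t / e" "g t / e \<le> of_int j + 1" unfolding j_def by linarith+
    then have "e * of_int j \<le> g t" "g t \<le> e * of_int j + e"
      using e by (simp_all add: field_simps)
    then show "\<bar>g t - (\<Sum>i\<in>{-N..N}. e * of_int i * indicator (E i) t)\<bar> \<le> e"
      unfolding eq by linarith
  qed
qed

text \<open>Step functions are tested by linearity. A uniform approximation of \<open>g\<close> by
  step functions then suffices, because the common bound on the L1 norms makes its error independent
  of \<open>n\<close>.\<close>

lemma setwise_limit_imp_bounded_test_limit:
  fixes u :: "nat \<Rightarrow> 'a \<Rightarrow> real"
  assumes u: "\<And>n. integrable M (u n)" and v: "integrable M v"
    and B: "\<And>n. (LINT t|M. \<bar>u n t\<bar>) \<le> B"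
    and lim: "\<And>E. E \<in> sets M \<Longrightarrow>
      (\<lambda>n. LINT t|M. indicator E t * u n t) \<longlonglongrightarrow> (LINT t|M. indicator E t * v t)"
    and g: "g \<in> borel_measurable M" "AE t in M. \<bar>g t\<bar> \<le> C"
  shows "(\<lambda>n. LINT t|M. u n t * g t) \<longlonglongrightarrow> (LINT t|M. v t * g t)"
proof (rule LIMSEQ_I)
  fix r :: real assume r: "0 < r"
  define B' where "B' = \<bar>B\<bar> + (LINT t|M. \<bar>v t\<bar>) + 1"
  have v0: "0 \<le> (LINT t|M. \<bar>v t\<bar>)" by (rule integral_nonneg_AE) auto
  have B'0: "0 < B'" "(LINT t|M. \<bar>u n t\<bar>) \<le> B'" "(LINT t|M. \<bar>v t\<bar>) \<le> B'" for n
    using v0 B[of n] unfolding B'_def by linarith+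
  \<comment> \<open>Replacing \<open>g\<close> by the step function \<open>h\<close> costs at most e
    * B' = r / 3, both along the sequence and at the limit. The summand 1 in B' keeps the divisor
    positive.\<close>
  define e where "e = r / (3 * B')"
  have e: "0 < e" using r B'0 by (simp add: e_def)
  obtain I :: "int set" and a E where I: "finite I" "\<And>i. E i \<in> sets M"
    and ge: "AE t in M. \<bar>g t - (\<Sum>i\<in>I. a i * indicator (E i) t)\<bar> \<le> e"
    by (rule AE_bounded_uniform_step_approximation[OF g e]) (rule that)
  define h where "h = (\<lambda>t. \<Sum>i\<in>I. a i * indicator (E i) t)"
  have h[measurable]: "h \<in> borel_measurable M" unfolding h_def using I(2) by auto
  have gh: "(\<lambda>t. g t - h t) \<in> borel_measurable M" using g(1) by auto
  have hint: "integrable M (\<lambda>t. w t * h t)"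
    "(LINT t|M. w t * h t) = (\<Sum>i\<in>I. a i * (LINT t|M. indicator (E i) t * w t))"
    if w: "integrable M w" for w :: "'a \<Rightarrow> real"
  proof -
    have i: "integrable M (\<lambda>t. a i * (indicator (E i) t * w t))" for i
      using integrable_mult_indicator[OF I(2)[of i] w] by simp
    have eq: "w t * h t = (\<Sum>i\<in>I. a i * (indicator (E i) t * w t))" for t
      by (simp add: h_def sum_distrib_left mult_ac)
    show "integrable M (\<lambda>t. w t * h t)"
      unfolding eq by (intro Bochner_Integration.integrable_sum i)
    show "(LINT t|M. w t * h t) = (\<Sum>i\<in>I. a i * (LINT t|M. indicator (E i) t * w t))"
      unfolding eq using i by (subst Bochner_Integration.integral_sum) auto
  qed
  have close: "\<bar>(LINT t|M. w t * g t) - (LINT t|M. w t * h t)\<bar> \<le> r / 3"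
    if w: "integrable M w" and wB: "(LINT t|M. \<bar>w t\<bar>) \<le> B'" for w
  proof -
    have int: "integrable M (\<lambda>t. w t * (g t - h t))"
      using integrable_mult_AE_bounded[OF w gh] ge by (simp add: h_def)
    have "(LINT t|M. w t * g t) - (LINT t|M. w t * h t) = (LINT t|M. w t * (g t - h t))"
      using integrable_mult_AE_bounded[OF w g] hint(1)[OF w] by (simp add: right_diff_distrib)
    also have "\<bar>\<dots>\<bar> \<le> (LINT t|M. \<bar>w t * (g t - h t)\<bar>)"
      by (rule integral_abs_bound)
    also have "\<dots> \<le> (LINT t|M. e * \<bar>w t\<bar>)"
    proof (rule integral_mono_AE)
      show "AE t in M. \<bar>w t * (g t - h t)\<bar> \<le> e * \<bar>w t\<bar>"
        using ge by (elim AE_mp)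
          (auto intro!: mult_right_mono simp: h_def abs_mult mult.commute[of "\<bar>w _\<bar>"])
    qed (use w int in auto)
    also have "\<dots> \<le> e * B'" using wB e by simp
    also have "\<dots> = r / 3" using B'0(1) by (simp add: e_def)
    finally show ?thesis .
  qed
  have "(\<lambda>n. LINT t|M. u n t * h t) \<longlonglongrightarrow> (LINT t|M. v t * h t)"
    unfolding hint(2)[OF u] hint(2)[OF v] by (intro tendsto_sum tendsto_mult_left lim I(2))
  then obtain n0 where n0: "\<And>n. n \<ge> n0 \<Longrightarrow> \<bar>(LINT t|M. u n t * h t) - (LINT t|M. v t * h t)\<bar> < r / 3"
    using LIMSEQ_D[of "\<lambda>n. LINT t|M. u n t * h t" "LINT t|M. v t * h t" "r / 3"] r by auto
  have "norm ((LINT t|M. u n t * g t) - (LINT t|M. v t * g t)) < r" if "n \<ge> n0" for n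
    using n0[OF that] close[OF u B'0(2), of n] close[OF v B'0(3)] unfolding real_norm_def by linarith
  then show "\<exists>n0. \<forall>n\<ge>n0. norm ((LINT t|M. u n t * g t) - (LINT t|M. v t * g t)) < r"
    by blast
qed

text \<open>The compactness half of Dunford-Pettis for nonnegative functions. Integrals over a
  countable dense family of sets converge along a diagonal subsequence; uniform integrability
  extends this to all measurable sets and passes to the limiting charge as absolute continuity, so
  that the charge has a density.\<close>

lemma uniformly_integrable_weak_subsequence:
  fixes \<Omega> :: "'a::euclidean_space set" and u :: "nat \<Rightarrow> 'a \<Rightarrow> real"
  assumes \<Omega>: "\<Omega> \<in> lmeasurable"
    and u: "\<And>n. integrable (lebesgue_on \<Omega>) (u n)"
    and nonneg: "\<And>n. AE t in lebesgue_on \<Omega>. 0 \<le> u n t"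
    and B: "\<And>n. (LINT t|lebesgue_on \<Omega>. u n t) \<le> B"
    and ui: "\<And>e. 0 < e \<Longrightarrow> \<exists>d>0. \<forall>E\<in>sets (lebesgue_on \<Omega>). measure (lebesgue_on \<Omega>) E < d \<longrightarrow>
      (\<forall>n. (LINT t|lebesgue_on \<Omega>. indicator E t * u n t) \<le> e)"
  obtains r v where "strict_mono r" "integrable (lebesgue_on \<Omega>) v"
    "\<And>g C. g \<in> borel_measurable (lebesgue_on \<Omega>) \<Longrightarrow> AE t in lebesgue_on \<Omega>. \<bar>g t\<bar> \<le> C \<Longrightarrow>
      (\<lambda>n. LINT t|lebesgue_on \<Omega>. u (r n) t * g t) \<longlonglongrightarrow> (LINT t|lebesgue_on \<Omega>. v t * g t)"
proof -
  let ?M = "lebesgue_on \<Omega>"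
  have fM: "finite_measure ?M" using \<Omega> by (rule finite_measure_lebesgue_on)
  define J where "J n E = (LINT t|?M. indicator E t * u n t)" for n E
  have int: "integrable ?M (\<lambda>t. indicator E t * u n t)" if "E \<in> sets ?M" for E n
    using integrable_mult_indicator[OF that u] by simp
  have J0: "0 \<le> J n E" for n E
    unfolding J_def
    by (rule integral_nonneg_AE, use nonneg[of n] in \<open>elim AE_mp\<close>) (auto simp: indicator_def)
  have J_mono: "J n E \<le> J n E'" if "E \<in> sets ?M" "E' \<in> sets ?M" "E \<subseteq> E'" for n E E'
    unfolding J_def using that int
    by (intro integral_mono_AE, auto, use nonneg[of n] in \<open>elim AE_mp\<close>) (auto simp: indicator_def)
  have J_add: "J n (E \<union> E') = J n E + J n E'"
    if "E \<in> sets ?M" "E' \<in> sets ?M" "E \<inter> E' = {}" for n E E'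
  proof -
    have "indicator (E \<union> E') t * u n t = indicator E t * u n t + indicator E' t * u n t" for t
      using that(3) by (auto simp: indicator_def)
    then show ?thesis unfolding J_def using int that by simp
  qed
  have J_B: "J n E \<le> B" if "E \<in> sets ?M" for n E
  proof -
    have "J n E \<le> J n (space ?M)" using that sets.sets_into_space[OF that] by (intro J_mono) auto
    also have "J n (space ?M) = (LINT t|?M. u n t)"
      unfolding J_def by (intro Bochner_Integration.integral_cong) auto
    finally show ?thesis using B[of n] by simp
  qed
  obtain F where F: "countable F" "F \<subseteq> sets ?M"
    "\<And>E e. E \<in> sets ?M \<Longrightarrow> 0 < e \<Longrightarrow> \<exists>E'\<in>F. measure ?M ((E - E') \<union> (E' - E)) < e"
    using lebesgue_on_countable_dense_sets[OF \<Omega>] by metis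
  \<comment> \<open>A diagonal extraction for bounded functions on a countable set, whose points are
    here the sets in \<open>F\<close>.\<close>
  obtain r where r: "strict_mono r" "\<And>E. E \<in> F \<Longrightarrow> \<exists>l. (\<lambda>n. J (r n) E) \<longlonglongrightarrow> l"
  proof (rule function_convergent_subsequence[OF F(1), of J B])
    show "norm (J n E) \<le> B" if "E \<in> F" for n E
      using J0 J_B F(2) that by auto
  qed (rule that)
  \<comment> \<open>Exchanging \<open>E\<close> for a nearby E' in \<open>F\<close> changes the
    integrals by at most e / 4 uniformly in \<open>n\<close>, so the Cauchy property carries over
    from E' to \<open>E\<close>.\<close>
  have "convergent (\<lambda>n. J (r n) E)" if E: "E \<in> sets ?M" for E
    unfolding Cauchy_convergent_iff[symmetric]
  proof (rule CauchyI)
    fix e :: real assume e: "0 < e"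
    obtain d where d: "0 < d"
      "\<And>X n. X \<in> sets ?M \<Longrightarrow> measure ?M X < d \<Longrightarrow> J n X \<le> e / 4"
      using ui[of "e / 4"] e unfolding J_def by auto
    obtain E' where E': "E' \<in> F" "measure ?M ((E - E') \<union> (E' - E)) < d"
      using F(3)[OF E d(1)] by auto
    have E's: "E' \<in> sets ?M" using E' F(2) by auto
    have close: "\<bar>J n E - J n E'\<bar> \<le> e / 4" for n
    proof -
      have "J n E = J n (E \<inter> E') + J n (E - E')" "J n E' = J n (E \<inter> E') + J n (E' - E)"
        using E E's by (subst J_add[symmetric]; auto intro!: arg_cong[of _ _ "J n"])+
      moreover have "J n (E - E') \<le> e / 4" "J n (E' - E) \<le> e / 4"
        using E E's E'(2) J_mono[of "E - E'" "(E - E') \<union> (E' - E)" n]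
          J_mono[of "E' - E" "(E - E') \<union> (E' - E)" n] d(2)[of "(E - E') \<union> (E' - E)" n]
        by auto
      ultimately show ?thesis using J0[of n "E - E'"] J0[of n "E' - E"] by linarith
    qed
    have "Cauchy (\<lambda>n. J (r n) E')" using r(2)[OF E'(1)] by (auto intro: convergentI convergent_Cauchy)
    then obtain n0 where n0: "\<And>m n. n0 \<le> m \<Longrightarrow> n0 \<le> n \<Longrightarrow> \<bar>J (r m) E' - J (r n) E'\<bar> < e / 4"
      using CauchyD[of "\<lambda>n. J (r n) E'" "e / 4"] e by auto
    have "\<bar>J (r m) E - J (r n) E\<bar> < e" if "n0 \<le> m" "n0 \<le> n" for m n
      using n0[OF that] close[of "r m"] close[of "r n"] by linarith
    then show "\<exists>n0. \<forall>m\<ge>n0. \<forall>n\<ge>n0. norm (J (r m) E - J (r n) E) < e" by auto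
  qed
  then have lim: "(\<lambda>n. J (r n) E) \<longlonglongrightarrow> lim (\<lambda>n. J (r n) E)" if "E \<in> sets ?M" for E
    using that by (simp add: convergent_LIMSEQ_iff)
  define \<nu> where "\<nu> E = lim (\<lambda>n. J (r n) E)" for E
  obtain v where v: "integrable ?M v" "\<And>E. E \<in> sets ?M \<Longrightarrow> \<nu> E = (LINT t|?M. indicator E t * v t)"
  proof (rule density_of_absolutely_continuous_charge[OF fM, of \<nu>])
    show "0 \<le> \<nu> E" if "E \<in> sets ?M" for E
      unfolding \<nu>_def using lim[OF that] J0 by (intro LIMSEQ_le_const) auto
    show "\<nu> (E \<union> E') = \<nu> E + \<nu> E'" if "E \<in> sets ?M" "E' \<in> sets ?M" "E \<inter> E' = {}" for E E'
    proof (rule LIMSEQ_unique)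
      show "(\<lambda>n. J (r n) (E \<union> E')) \<longlonglongrightarrow> \<nu> (E \<union> E')" unfolding \<nu>_def using that by (intro lim) auto
      show "(\<lambda>n. J (r n) (E \<union> E')) \<longlonglongrightarrow> \<nu> E + \<nu> E'"
        unfolding \<nu>_def J_add[OF that] using that by (intro tendsto_add lim) auto
    qed
    show "\<exists>d>0. \<forall>E\<in>sets ?M. measure ?M E < d \<longrightarrow> \<nu> E \<le> e" if e: "0 < e" for e
    proof -
      obtain d where d: "0 < d" "\<And>X n. X \<in> sets ?M \<Longrightarrow> measure ?M X < d \<Longrightarrow> J n X \<le> e"
        using ui[OF e] unfolding J_def by auto
      have "\<nu> E \<le> e" if "E \<in> sets ?M" "measure ?M E < d" for E
        unfolding \<nu>_def using lim[OF that(1)] d(2)[OF that] by (intro LIMSEQ_le_const2) auto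
      then show ?thesis using d(1) by blast
    qed
  next
    fix f assume "integrable ?M f" "\<And>E. E \<in> sets ?M \<Longrightarrow> \<nu> E = (LINT t|?M. indicator E t * f t)"
    then show thesis by (rule that)
  qed
  show ?thesis
  proof (rule that[OF r(1) v(1)])
    fix g :: "'a \<Rightarrow> real" and C assume g: "g \<in> borel_measurable ?M" "AE t in ?M. \<bar>g t\<bar> \<le> C"
    show "(\<lambda>n. LINT t|?M. u (r n) t * g t) \<longlonglongrightarrow> (LINT t|?M. v t * g t)"
    proof (rule setwise_limit_imp_bounded_test_limit[OF u v(1) _ _ g, where B = B])
      fix n
      have "(LINT t|?M. \<bar>u (r n) t\<bar>) = (LINT t|?M. u (r n) t)"
        using u[of "r n"]
        by (intro integral_cong_AE, auto, use nonneg[of "r n"] in \<open>elim AE_mp\<close>) auto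
      then show "(LINT t|?M. \<bar>u (r n) t\<bar>) \<le> B" using B by simp
    next
      fix E assume "E \<in> sets ?M"
      then show "(\<lambda>n. LINT t|?M. indicator E t * u (r n) t) \<longlonglongrightarrow> (LINT t|?M. indicator E t * v t)"
        using lim[of E] v(2)[of E] by (simp add: \<nu>_def J_def)
    qed
  qed
qed

section \<open>Entropy bounds and uniform integrability\<close>

lemma mult_ln_ge: "x - 1 \<le> x * ln x" if "0 \<le> x" for x :: real
proof (cases "x = 0")
  case False
  then have "0 < x" using that by simp
  then have "ln (inverse x) \<le> inverse x - 1" by (intro ln_le_minus_one) simp
  then have "x * (1 - inverse x) \<le> x * ln x"
    using \<open>0 < x\<close> by (intro mult_left_mono) (auto simp: ln_inverse)
  then show ?thesis using \<open>0 < x\<close> by (simp add: right_diff_distrib)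
qed simp

text \<open>Superlinear growth in quantitative form: above \<open>R\<close> the logarithm is at
  least \<open>ln R\<close>. The summand 1 makes the quotient nonnegative, since x ln x + 1 >= x, so
  that the bound also holds below \<open>R\<close>.\<close>

lemma le_truncation_plus_entropy: "x \<le> R + (x * ln x + 1) / ln R" if "0 \<le> x" "1 < R" for x R :: real
proof (cases "x \<le> R")
  case True
  have "0 \<le> (x * ln x + 1) / ln R" using mult_ln_ge[OF that(1)] that by simp
  then show ?thesis using True by simp
next
  case False
  then have "x * ln R \<le> x * ln x" using that by (intro mult_left_mono) auto
  then have "x \<le> (x * ln x + 1) / ln R" using that by (simp add: pos_le_divide_eq)
  then show ?thesis using that by simp
qed

text \<open>The criterion of de la Vallee Poussin for x ln x: the integral over \<open>E\<close> is
  at most R |E| + Q / ln R, where first \<open>R\<close> is taken large and then |E| small.\<close>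

lemma entropy_bounded_weak_subsequence:
  fixes \<Omega> :: "'a::euclidean_space set" and u :: "nat \<Rightarrow> 'a \<Rightarrow> real"
  assumes \<Omega>: "\<Omega> \<in> lmeasurable"
    and u: "\<And>n. integrable (lebesgue_on \<Omega>) (u n)"
    and nonneg: "\<And>n. AE t in lebesgue_on \<Omega>. 0 \<le> u n t"
    and ent: "\<And>n. integrable (lebesgue_on \<Omega>) (\<lambda>t. u n t * ln (u n t))"
    and bnd: "\<And>n. (LINT t|lebesgue_on \<Omega>. u n t * ln (u n t)) \<le> B"
  obtains r v where "strict_mono r" "integrable (lebesgue_on \<Omega>) v"
    "\<And>g C. g \<in> borel_measurable (lebesgue_on \<Omega>) \<Longrightarrow> AE t in lebesgue_on \<Omega>. \<bar>g t\<bar> \<le> C \<Longrightarrow>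
      (\<lambda>n. LINT t|lebesgue_on \<Omega>. u (r n) t * g t) \<longlonglongrightarrow> (LINT t|lebesgue_on \<Omega>. v t * g t)"
proof -
  let ?M = "lebesgue_on \<Omega>"
  interpret finite_measure ?M using \<Omega> by (rule finite_measure_lebesgue_on)
  \<comment> \<open>Bounds the integral of u_n ln u_n + 1; the extra 1 makes it positive, so that
    \<open>R\<close> below exceeds 1.\<close>
  define Q where "Q = \<bar>B\<bar> + measure ?M (space ?M) + 1"
  have Q: "0 < Q" by (simp add: Q_def add_nonneg_pos)
  have main: "(LINT t|?M. indicator E t * u n t) \<le> R * measure ?M E + Q / ln R"
    if E: "E \<in> sets ?M" and R: "1 < R" for E R n
  proof -
    have i1: "integrable ?M (\<lambda>t. R * indicator E t)"
      using E emeasure_finite[of E] by (simp add: less_top[symmetric])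
    have i2: "integrable ?M (\<lambda>t. (u n t * ln (u n t) + 1) / ln R)"
      using ent[of n] by simp
    have "(LINT t|?M. indicator E t * u n t)
        \<le> (LINT t|?M. R * indicator E t + (u n t * ln (u n t) + 1) / ln R)"
    proof (rule integral_mono_AE)
      show "integrable ?M (\<lambda>t. indicator E t * u n t)"
        using integrable_mult_indicator[OF E u] by simp
      show "AE t in ?M. indicator E t * u n t \<le> R * indicator E t + (u n t * ln (u n t) + 1) / ln R"
        using nonneg[of n]
      proof (elim AE_mp, intro AE_I2 impI)
        fix t assume t: "0 \<le> u n t"
        have "0 \<le> (u n t * ln (u n t) + 1) / ln R" using mult_ln_ge[OF t] t R by simp
        then show "indicator E t * u n t \<le> R * indicator E t + (u n t * ln (u n t) + 1) / ln R"
          using le_truncation_plus_entropy[OF t R] by (auto simp: indicator_def)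
      qed
    qed (use i1 i2 in simp)
    also have "\<dots> = R * measure ?M E + ((LINT t|?M. u n t * ln (u n t)) + measure ?M (space ?M)) / ln R"
      using i1 i2 ent[of n] E sets.sets_into_space[OF E] by (simp add: Int_absorb2)
    also have "\<dots> \<le> R * measure ?M E + Q / ln R"
      using bnd[of n] R by (intro add_left_mono divide_right_mono) (auto simp: Q_def)
    finally show ?thesis .
  qed
  \<comment> \<open>The estimate \<open>main\<close> on the whole space with R = e, where ln R =
    1.\<close>
  have tot: "(LINT t|?M. u n t) \<le> exp 1 * measure ?M (space ?M) + Q" for n
  proof -
    have "(LINT t|?M. u n t) = (LINT t|?M. indicator (space ?M) t * u n t)"
      by (intro Bochner_Integration.integral_cong) auto
    then show ?thesis using main[OF sets.top, of "exp 1" n] by simp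
  qed
  have ui: "\<exists>d>0. \<forall>E\<in>sets ?M. measure ?M E < d \<longrightarrow> (\<forall>n. (LINT t|?M. indicator E t * u n t) \<le> e)"
    if e: "0 < e" for e
  proof -
    \<comment> \<open>Chosen so that Q / ln R is e / 2; the smallness of the set contributes the
      other half.\<close>
    define R where "R = exp (2 * Q / e)"
    have R: "1 < R" "Q / ln R = e / 2" using e Q by (simp_all add: R_def)
    have "(LINT t|?M. indicator E t * u n t) \<le> e"
      if E: "E \<in> sets ?M" "measure ?M E < e / (2 * R)" for E n
    proof -
      have "R * measure ?M E \<le> e / 2" using E(2) R(1) by (simp add: field_simps)
      then show ?thesis using main[OF E(1) R(1), of n] R(2) by linarith
    qed
    moreover have "0 < e / (2 * R)" using e R(1) by simp
    ultimately show ?thesis by blast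
  qed
  show ?thesis
    using uniformly_integrable_weak_subsequence[OF \<Omega> u nonneg tot ui] that by blast
qed

section \<open>The Kullback--Leibler divergence\<close>

text \<open>The divergence split into four integrals, each finite for \<open>w\<close> in
  \<open>dom_entropy\<close> and \<open>v\<close> in \<open>dom_subdiff_entropy\<close>. In this
  form the identities of the iteration are linear arithmetic over the reals.\<close>

definition KL_real :: "'a::euclidean_space set \<Rightarrow> ('a \<Rightarrow> real) \<Rightarrow> ('a \<Rightarrow> real) \<Rightarrow> real" where
  "KL_real \<Omega> w v = (LINT t|lebesgue_on \<Omega>. w t * ln (w t)) - (LINT t|lebesgue_on \<Omega>. w t * ln (v t))
     - (LINT t|lebesgue_on \<Omega>. w t) + (LINT t|lebesgue_on \<Omega>. v t)"

lemma dom_entropy_iff: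
  "w \<in> dom_entropy \<Omega> \<longleftrightarrow> integrable (lebesgue_on \<Omega>) w \<and> (AE t in lebesgue_on \<Omega>. 0 \<le> w t) \<and>
     integrable (lebesgue_on \<Omega>) (\<lambda>t. w t * ln (w t))"
  by (auto simp: dom_entropy_def entropy_def L1_def)

lemma dom_entropy_chi_iff:
  assumes "m \<in> {0, 1}"
  shows "w \<in> dom_entropy_chi \<Omega> m \<longleftrightarrow>
    w \<in> dom_entropy \<Omega> \<and> (m = 1 \<longrightarrow> (LINT t|lebesgue_on \<Omega>. w t) = 1)"
  using assms by (auto simp: dom_entropy_chi_def dom_entropy_def entropy_def chi_def)

text \<open>With q = r / s the expression is s (q - 1 - ln q), which is nonnegative and vanishes
  only at q = 1. The equality case is what later identifies the minimizer.\<close>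

lemma bregman_ln_nonneg:
  fixes s r :: real
  assumes "0 \<le> s" "0 < r"
  shows "0 \<le> s * ln s - s * ln r - s + r"
    and "s * ln s - s * ln r - s + r = 0 \<Longrightarrow> s = r"
proof -
  have *: "0 \<le> s * ln s - s * ln r - s + r \<and> (s * ln s - s * ln r - s + r = 0 \<longrightarrow> s = r)"
  proof (cases "s = 0")
    case False
    then have s: "0 < s" using assms by simp
    then have rs: "0 < r / s" using assms by simp
    have eq: "s * ln s - s * ln r - s + r = s * (r / s - 1 - ln (r / s))"
      using s assms by (simp add: ln_div field_simps)
    have "ln (r / s) \<le> r / s - 1" using rs by (rule ln_le_minus_one)
    moreover have "r / s = 1" if "ln (r / s) = r / s - 1"
      using rs that by (rule ln_eq_minus_one)
    ultimately show ?thesis unfolding eq using s by auto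
  qed (use assms in auto)
  then show "0 \<le> s * ln s - s * ln r - s + r"
    and "s * ln s - s * ln r - s + r = 0 \<Longrightarrow> s = r" by auto
qed

lemma dom_subdiff_entropyE:
  assumes "v \<in> dom_subdiff_entropy \<Omega>"
  obtains \<alpha> \<beta> where "0 < \<alpha>" "AE t in lebesgue_on \<Omega>. \<alpha> \<le> v t \<and> v t \<le> \<beta>"
    "integrable (lebesgue_on \<Omega>) v"
  using assms by (auto simp: dom_subdiff_entropy_def L1_def)

lemma dom_subdiff_entropy_AE_pos:
  "v \<in> dom_subdiff_entropy \<Omega> \<Longrightarrow> AE t in lebesgue_on \<Omega>. 0 < v t"
  by (erule dom_subdiff_entropyE, erule AE_mp) auto

lemma ln_dom_subdiff_entropy_bounded:
  assumes "v \<in> dom_subdiff_entropy \<Omega>"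
  obtains C where "(\<lambda>t. ln (v t)) \<in> borel_measurable (lebesgue_on \<Omega>)"
    "AE t in lebesgue_on \<Omega>. \<bar>ln (v t)\<bar> \<le> C"
proof -
  obtain \<alpha> \<beta> where v: "0 < \<alpha>" "AE t in lebesgue_on \<Omega>. \<alpha> \<le> v t \<and> v t \<le> \<beta>"
    "integrable (lebesgue_on \<Omega>) v" using assms by (rule dom_subdiff_entropyE)
  have "AE t in lebesgue_on \<Omega>. \<bar>ln (v t)\<bar> \<le> \<bar>ln \<alpha>\<bar> + \<bar>ln \<beta>\<bar>"
    using v(2)
  proof (elim AE_mp, intro AE_I2 impI)
    fix t assume "\<alpha> \<le> v t \<and> v t \<le> \<beta>"
    then have "ln \<alpha> \<le> ln (v t)" "ln (v t) \<le> ln \<beta>" using v(1) by auto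
    then show "\<bar>ln (v t)\<bar> \<le> \<bar>ln \<alpha>\<bar> + \<bar>ln \<beta>\<bar>" by linarith
  qed
  moreover have "(\<lambda>t. ln (v t)) \<in> borel_measurable (lebesgue_on \<Omega>)" using v(3) by measurable
  ultimately show ?thesis using that by blast
qed

lemma integrable_mult_ln:
  assumes "integrable (lebesgue_on \<Omega>) w" "v \<in> dom_subdiff_entropy \<Omega>"
  shows "integrable (lebesgue_on \<Omega>) (\<lambda>t. w t * ln (v t))"
  using ln_dom_subdiff_entropy_bounded[OF assms(2)] integrable_mult_AE_bounded[OF assms(1)] by metis

lemma dom_subdiff_entropy_integrable: "v \<in> dom_subdiff_entropy \<Omega> \<Longrightarrow> integrable (lebesgue_on \<Omega>) v"
  by (rule dom_subdiff_entropyE)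

lemma dom_subdiff_entropy_subset: "v \<in> dom_subdiff_entropy \<Omega> \<Longrightarrow> v \<in> dom_entropy \<Omega>"
  unfolding dom_entropy_iff
  using integrable_mult_ln[OF dom_subdiff_entropy_integrable, of v \<Omega> v] dom_subdiff_entropy_AE_pos[of v \<Omega>]
  by (auto simp: dom_subdiff_entropy_integrable elim!: AE_mp)

lemma bregman_ln_integrable:
  assumes w: "w \<in> dom_entropy \<Omega>" and v: "v \<in> dom_subdiff_entropy \<Omega>"
  shows "integrable (lebesgue_on \<Omega>) (\<lambda>t. w t * ln (w t) - w t * ln (v t) - w t + v t)"
    and "(LINT t|lebesgue_on \<Omega>. w t * ln (w t) - w t * ln (v t) - w t + v t) = KL_real \<Omega> w v"
    and "AE t in lebesgue_on \<Omega>. 0 \<le> w t * ln (w t) - w t * ln (v t) - w t + v t"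
proof -
  have w': "integrable (lebesgue_on \<Omega>) w" "integrable (lebesgue_on \<Omega>) (\<lambda>t. w t * ln (w t))"
    "AE t in lebesgue_on \<Omega>. 0 \<le> w t"
    using w by (auto simp: dom_entropy_iff)
  note i = w' dom_subdiff_entropy_integrable[OF v] integrable_mult_ln[OF w'(1) v]
  show "integrable (lebesgue_on \<Omega>) (\<lambda>t. w t * ln (w t) - w t * ln (v t) - w t + v t)"
    using i by simp
  show "(LINT t|lebesgue_on \<Omega>. w t * ln (w t) - w t * ln (v t) - w t + v t) = KL_real \<Omega> w v"
    using i by (simp add: KL_real_def)
  show "AE t in lebesgue_on \<Omega>. 0 \<le> w t * ln (w t) - w t * ln (v t) - w t + v t"
    using w'(3) dom_subdiff_entropy_AE_pos[OF v] by eventually_elim (rule bregman_ln_nonneg)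
qed

text \<open>Positivity of \<open>v\<close> almost everywhere excludes the infinite branch of
  \<open>log_ratio_term\<close>, and by nonnegativity of the integrand its extended integral is the
  ordinary one.\<close>

lemma KL_eq_KL_real:
  assumes w: "w \<in> dom_entropy \<Omega>" and v: "v \<in> dom_subdiff_entropy \<Omega>"
  shows "KL \<Omega> w v = ereal (KL_real \<Omega> w v)" and "0 \<le> KL_real \<Omega> w v"
proof -
  note i = bregman_ln_integrable[OF w v]
  show nonneg: "0 \<le> KL_real \<Omega> w v"
    unfolding i(2)[symmetric] by (rule integral_nonneg_AE[OF i(3)])
  have w0: "AE t in lebesgue_on \<Omega>. 0 \<le> w t" using w by (simp add: dom_entropy_iff)
  have "AE t in lebesgue_on \<Omega>. e2ennreal (log_ratio_term (w t) (v t) - ereal (w t) + ereal (v t))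
      = ennreal (w t * ln (w t) - w t * ln (v t) - w t + v t)"
    using w0 dom_subdiff_entropy_AE_pos[OF v]
  proof eventually_elim
    fix t assume t: "0 \<le> w t" "0 < v t"
    have "log_ratio_term (w t) (v t) = ereal (w t * ln (w t) - w t * ln (v t))"
      using t by (auto simp: log_ratio_term_def ln_div right_diff_distrib zero_ereal_def)
    then show "e2ennreal (log_ratio_term (w t) (v t) - ereal (w t) + ereal (v t))
      = ennreal (w t * ln (w t) - w t * ln (v t) - w t + v t)"
      by (simp add: e2ennreal_ereal)
  qed
  then have "(\<integral>\<^sup>+t. e2ennreal (log_ratio_term (w t) (v t) - ereal (w t) + ereal (v t)) \<partial>lebesgue_on \<Omega>)
      = (\<integral>\<^sup>+t. ennreal (w t * ln (w t) - w t * ln (v t) - w t + v t) \<partial>lebesgue_on \<Omega>)"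
    by (rule nn_integral_cong_AE)
  also have "\<dots> = ennreal (KL_real \<Omega> w v)"
    using nn_integral_eq_integral[OF i(1,3)] by (simp add: i(2))
  finally show "KL \<Omega> w v = ereal (KL_real \<Omega> w v)"
    unfolding KL_def using nonneg by simp
qed

lemma KL_real_self [simp]: "KL_real \<Omega> v v = 0"
  by (simp add: KL_real_def)

lemma KL_real_eq_0_imp_AE_eq:
  assumes w: "w \<in> dom_entropy \<Omega>" and v: "v \<in> dom_subdiff_entropy \<Omega>" and "KL_real \<Omega> w v = 0"
  shows "AE t in lebesgue_on \<Omega>. w t = v t"
proof -
  note i = bregman_ln_integrable[OF w v]
  have "AE t in lebesgue_on \<Omega>. w t * ln (w t) - w t * ln (v t) - w t + v t = 0"
    using integral_nonneg_eq_0_iff_AE[OF i(1,3)] i(2) assms(3) by simp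
  moreover have "AE t in lebesgue_on \<Omega>. 0 \<le> w t" using w by (simp add: dom_entropy_iff)
  ultimately show ?thesis using dom_subdiff_entropy_AE_pos[OF v]
    by eventually_elim (rule bregman_ln_nonneg(2))
qed

lemma KL_real_cong_AE:
  assumes w: "integrable (lebesgue_on \<Omega>) w" and v: "v \<in> dom_subdiff_entropy \<Omega>"
    and v': "v' \<in> dom_subdiff_entropy \<Omega>" and eq: "AE t in lebesgue_on \<Omega>. v t = v' t"
  shows "KL_real \<Omega> w v = KL_real \<Omega> w v'"
proof -
  have "(LINT t|lebesgue_on \<Omega>. v t) = (LINT t|lebesgue_on \<Omega>. v' t)"
    using dom_subdiff_entropy_integrable[OF v] dom_subdiff_entropy_integrable[OF v'] eq
    by (intro integral_cong_AE) auto
  moreover have "(LINT t|lebesgue_on \<Omega>. w t * ln (v t)) = (LINT t|lebesgue_on \<Omega>. w t * ln (v' t))"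
    using integrable_mult_ln[OF w v] integrable_mult_ln[OF w v'] eq
    by (intro integral_cong_AE) (auto elim!: AE_mp)
  ultimately show ?thesis by (simp add: KL_real_def)
qed

lemma dom_subdiff_entropy_cong_AE:
  assumes v: "v \<in> dom_subdiff_entropy \<Omega>" and w: "integrable (lebesgue_on \<Omega>) w"
    and eq: "AE t in lebesgue_on \<Omega>. w t = v t"
  shows "w \<in> dom_subdiff_entropy \<Omega>"
proof -
  obtain \<alpha> \<beta> where "0 < \<alpha>" "AE t in lebesgue_on \<Omega>. \<alpha> \<le> v t \<and> v t \<le> \<beta>"
    using v by (rule dom_subdiff_entropyE)
  then have "AE t in lebesgue_on \<Omega>. \<alpha> \<le> w t \<and> w t \<le> \<beta>" using eq by (auto elim: AE_mp)
  then show ?thesis using \<open>0 < \<alpha>\<close> w by (auto simp: dom_subdiff_entropy_def L1_def)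
qed

section \<open>Bounded functionals on L1 and the adjoint of A\<close>

lemma bounded_linear_L1_repr:
  fixes \<phi> :: "('a::euclidean_space \<Rightarrow> real) \<Rightarrow> real"
  assumes \<Omega>: "\<Omega> \<in> lmeasurable" and \<phi>: "bounded_linear_L1 \<Omega> \<phi>"
  obtains g C where "g \<in> borel_measurable (lebesgue_on \<Omega>)" "AE t in lebesgue_on \<Omega>. \<bar>g t\<bar> \<le> C"
    "\<And>u. u \<in> L1 \<Omega> \<Longrightarrow> \<phi> u = (LINT t|lebesgue_on \<Omega>. u t * g t)"
proof -
  obtain K where K: "\<And>u. u \<in> L1 \<Omega> \<Longrightarrow> norm (\<phi> u) \<le> K * (LINT t|lebesgue_on \<Omega>. \<bar>u t\<bar>)"
    using \<phi> unfolding bounded_linear_L1_def by blast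
  show ?thesis
  proof (rule bounded_functional_on_integrable_repr[of "lebesgue_on \<Omega>" \<phi> K])
    show "finite_measure (lebesgue_on \<Omega>)" using \<Omega> by (rule finite_measure_lebesgue_on)
  qed (use \<phi> K that in \<open>auto simp: bounded_linear_L1_def L1_def\<close>)
qed

lemma bounded_linear_L1_inner:
  assumes "bounded_linear_L1 \<Omega> A"
  shows "bounded_linear_L1 \<Omega> (\<lambda>u. inner (A u) w)"
proof -
  obtain K where K: "\<And>u. u \<in> L1 \<Omega> \<Longrightarrow> norm (A u) \<le> K * (LINT t|lebesgue_on \<Omega>. \<bar>u t\<bar>)"
    using assms unfolding bounded_linear_L1_def by blast
  have "norm (inner (A u) w) \<le> (K * norm w) * (LINT t|lebesgue_on \<Omega>. \<bar>u t\<bar>)" if "u \<in> L1 \<Omega>" for u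
  proof -
    have "norm (inner (A u) w) \<le> norm (A u) * norm w"
      by (simp add: Cauchy_Schwarz_ineq2)
    also have "\<dots> \<le> (K * (LINT t|lebesgue_on \<Omega>. \<bar>u t\<bar>)) * norm w"
      using K[OF that] by (rule mult_right_mono) simp
    finally show ?thesis by (simp add: mult_ac)
  qed
  then show ?thesis
    using assms unfolding bounded_linear_L1_def by (auto simp: inner_add_left)
qed

text \<open>The adjoint value is the bounded function that represents the functional u -> <A u, w>.
  It supplies the exponent of the multiplicative update.\<close>

lemma adjoint_value_exists:
  assumes "\<Omega> \<in> lmeasurable" and "bounded_linear_L1 \<Omega> A"
  shows "\<exists>g. adjoint_value \<Omega> A w g"
proof -
  obtain g C where g: "g \<in> borel_measurable (lebesgue_on \<Omega>)" "AE t in lebesgue_on \<Omega>. \<bar>g t\<bar> \<le> C"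
    "\<And>u. u \<in> L1 \<Omega> \<Longrightarrow> inner (A u) w = (LINT t|lebesgue_on \<Omega>. u t * g t)"
    by (rule bounded_linear_L1_repr[OF assms(1) bounded_linear_L1_inner[OF assms(2), of w]]) (rule that)
  then have "adjoint_value \<Omega> A w g" by (auto simp: adjoint_value_def Linf_def)
  then show ?thesis by blast
qed

section \<open>One step of the iteration\<close>

lemma exponential_step_in_dom_subdiff:
  assumes v: "v \<in> dom_subdiff_entropy \<Omega>"
    and g: "g \<in> borel_measurable (lebesgue_on \<Omega>)" "AE t in lebesgue_on \<Omega>. \<bar>g t\<bar> \<le> C"
  shows "(\<lambda>t. v t * exp (g t)) \<in> dom_subdiff_entropy \<Omega>"
proof -
  obtain \<alpha> \<beta> where ab: "0 < \<alpha>" "AE t in lebesgue_on \<Omega>. \<alpha> \<le> v t \<and> v t \<le> \<beta>"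
    "integrable (lebesgue_on \<Omega>) v" using v by (rule dom_subdiff_entropyE)
  have eg: "AE t in lebesgue_on \<Omega>. exp (- C) \<le> exp (g t) \<and> exp (g t) \<le> exp C"
    using g(2) by (elim AE_mp) auto
  have "integrable (lebesgue_on \<Omega>) (\<lambda>t. v t * exp (g t))"
  proof (rule integrable_mult_AE_bounded[OF ab(3), where C = "exp C"])
    show "(\<lambda>t. exp (g t)) \<in> borel_measurable (lebesgue_on \<Omega>)" using g(1) by measurable
    show "AE t in lebesgue_on \<Omega>. \<bar>exp (g t)\<bar> \<le> exp C" using eg by (elim AE_mp) auto
  qed
  moreover have "AE t in lebesgue_on \<Omega>. \<alpha> * exp (- C) \<le> v t * exp (g t) \<and> v t * exp (g t) \<le> \<beta> * exp C"
    using ab(2) eg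
  proof eventually_elim
    case (elim t)
    then show ?case using ab(1) by (auto intro!: mult_mono)
  qed
  moreover have "0 < \<alpha> * exp (- C)" using ab(1) by simp
  ultimately show ?thesis unfolding dom_subdiff_entropy_def L1_def by blast
qed

lemma step_functional_eq:
  fixes A :: "('a::euclidean_space \<Rightarrow> real) \<Rightarrow> 'y::real_inner"
  assumes w: "w \<in> dom_entropy \<Omega>" and uk: "uk \<in> dom_subdiff_entropy \<Omega>"
    and m: "m \<in> {0, 1}" "m = 1 \<longrightarrow> (LINT t|lebesgue_on \<Omega>. w t) = 1"
  shows "step_functional \<Omega> A c m yd uk w
    = ereal (inner (A w - yd) (A uk - yd) + c * KL_real \<Omega> w uk)"
  using m by (auto simp: step_functional_def KL_eq_KL_real[OF w uk] chi_def)

text \<open>The logarithm of the update \<open>v\<close> exceeds that of \<open>uk\<close> by a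
  representative of the adjoint at (yd - A uk) / c plus a constant, so the linear term of the
  objective is absorbed into the divergence from \<open>v\<close>. The third conclusion is the
  resulting three-point identity. The fourth is the update of the logarithm, tested on functions
  that do not see the constant.\<close>

lemma entropic_step:
  fixes A :: "('a::euclidean_space \<Rightarrow> real) \<Rightarrow> 'y::real_inner"
  assumes \<Omega>: "\<Omega> \<in> lmeasurable" and A: "bounded_linear_L1 \<Omega> A"
    and m: "m \<in> {0, 1}" and c: "0 < c"
    and uk: "uk \<in> dom_subdiff_entropy \<Omega>" "m = 1 \<longrightarrow> (LINT t|lebesgue_on \<Omega>. uk t) = 1"
    and min: "is_arg_min (step_functional \<Omega> A c m yd uk) (\<lambda>w. w \<in> dom_entropy \<Omega>) u'"
  shows "u' \<in> dom_subdiff_entropy \<Omega>"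
    and "m = 1 \<longrightarrow> (LINT t|lebesgue_on \<Omega>. u' t) = 1"
    and "\<And>w. w \<in> dom_entropy \<Omega> \<Longrightarrow> m = 1 \<longrightarrow> (LINT t|lebesgue_on \<Omega>. w t) = 1 \<Longrightarrow>
      inner (A w) (A uk - yd) + c * KL_real \<Omega> w uk
      = c * KL_real \<Omega> w u' + (inner (A u') (A uk - yd) + c * KL_real \<Omega> u' uk)"
    and "\<And>x. x \<in> L1 \<Omega> \<Longrightarrow> m = 1 \<longrightarrow> (LINT t|lebesgue_on \<Omega>. x t) = 0 \<Longrightarrow>
      (LINT t|lebesgue_on \<Omega>. x t * ln (u' t))
      = (LINT t|lebesgue_on \<Omega>. x t * ln (uk t)) + inner (A x) (yd - A uk) / c"
proof -
  let ?M = "lebesgue_on \<Omega>"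
  obtain g where "adjoint_value \<Omega> A (yd - A uk) g" using adjoint_value_exists[OF \<Omega> A] by blast
  then obtain C where g[measurable]: "g \<in> borel_measurable ?M" and gC: "AE t in ?M. \<bar>g t\<bar> \<le> C"
    and Ag: "\<And>x. x \<in> L1 \<Omega> \<Longrightarrow> inner (A x) (yd - A uk) = (LINT t|?M. x t * g t)"
    by (auto simp: adjoint_value_def Linf_def)
  define e where "e t = g t / c" for t
  have e: "e \<in> borel_measurable ?M" "AE t in ?M. \<bar>e t\<bar> \<le> C / c"
    using gC c by (auto simp: e_def[abs_def] divide_right_mono elim!: AE_mp)
  define Z where "Z = (LINT t|?M. uk t * exp (e t))"
  \<comment> \<open>The logarithm of the factor c_k^m: it is 0 for m = 0, and for m = 1 it gives
    \<open>v\<close> integral 1.\<close>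
  define \<kappa> where "\<kappa> = (if m = 0 then 0 else - ln Z)"
  define v where "v t = uk t * exp (e t + \<kappa>)" for t
  have Ze: "(\<lambda>t. uk t * exp (e t)) \<in> dom_subdiff_entropy \<Omega>"
    by (rule exponential_step_in_dom_subdiff[OF uk(1) e])
  have v: "v \<in> dom_subdiff_entropy \<Omega>"
    unfolding v_def
  proof (rule exponential_step_in_dom_subdiff[OF uk(1)])
    show "(\<lambda>t. e t + \<kappa>) \<in> borel_measurable ?M" using e(1) by measurable
    show "AE t in ?M. \<bar>e t + \<kappa>\<bar> \<le> C / c + \<bar>\<kappa>\<bar>"
      using e(2) by (elim AE_mp) auto
  qed
  have uk_int: "integrable ?M uk" and v_int: "integrable ?M v"
    using uk(1) v dom_subdiff_entropy_integrable by auto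
  have uk_pos: "AE t in ?M. 0 < uk t" using dom_subdiff_entropy_AE_pos[OF uk(1)] .
  have v_norm: "(LINT t|?M. v t) = 1" if "m = 1"
  proof -
    \<comment> \<open>Taking \<open>ln Z\<close> requires positive Z: the exponent is at least -C/c
      almost everywhere, and \<open>uk\<close> has integral 1.\<close>
    have "exp (- (C / c)) * (LINT t|?M. uk t) = (LINT t|?M. exp (- (C / c)) * uk t)" by simp
    also have "\<dots> \<le> Z"
      unfolding Z_def
    proof (rule integral_mono_AE)
      show "AE t in ?M. exp (- (C / c)) * uk t \<le> uk t * exp (e t)"
        using e(2) uk_pos
      proof eventually_elim
        case (elim t)
        then have "- (C / c) \<le> e t" by linarith
        then show ?case using elim by (simp add: mult.commute)
      qed
    qed (use uk_int dom_subdiff_entropy_integrable[OF Ze] in auto)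
    finally have "0 < Z" using uk(2) that by (simp add: less_le_trans[OF exp_gt_zero])
    have "(LINT t|?M. v t) = (LINT t|?M. (uk t * exp (e t)) * exp \<kappa>)"
      by (simp add: v_def exp_add mult_ac)
    also have "\<dots> = Z * exp \<kappa>" unfolding Z_def by (rule integral_mult_left_zero)
    finally show ?thesis using \<open>0 < Z\<close> that by (simp add: \<kappa>_def exp_minus)
  qed
  have ln_v: "(LINT t|?M. x t * ln (v t))
      = (LINT t|?M. x t * ln (uk t)) + inner (A x) (yd - A uk) / c + \<kappa> * (LINT t|?M. x t)"
    if x: "x \<in> L1 \<Omega>" for x
  proof -
    have x': "integrable ?M x" using x by (simp add: L1_def)
    have i: "integrable ?M (\<lambda>t. x t * ln (uk t))" "integrable ?M (\<lambda>t. x t * e t)" "integrable ?M (\<lambda>t. \<kappa> * x t)"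
      using integrable_mult_ln[OF x' uk(1)] integrable_mult_AE_bounded[OF x' e] x' by auto
    have "(LINT t|?M. x t * ln (v t)) = (LINT t|?M. x t * ln (uk t) + x t * e t + \<kappa> * x t)"
    proof (rule integral_cong_AE)
      show "AE t in ?M. x t * ln (v t) = x t * ln (uk t) + x t * e t + \<kappa> * x t"
        using uk_pos by eventually_elim (simp add: v_def ln_mult algebra_simps)
    qed (use integrable_mult_ln[OF x' v] i in auto)
    also have "\<dots> = (LINT t|?M. x t * ln (uk t)) + (LINT t|?M. x t * e t) + \<kappa> * (LINT t|?M. x t)"
      using i by simp
    also have "(LINT t|?M. x t * e t) = inner (A x) (yd - A uk) / c"
      unfolding Ag[OF x] e_def by simp
    finally show ?thesis .
  qed
  define S where "S w = inner (A w) (A uk - yd) + c * KL_real \<Omega> w uk" for w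
  have S: "S w = c * KL_real \<Omega> w v + S v"
    if w: "w \<in> dom_entropy \<Omega>" "m = 1 \<longrightarrow> (LINT t|?M. w t) = 1" for w
  proof -
    \<comment> \<open>The remainder does not depend on \<open>w\<close>, because \<kappa> times the
      integral of \<open>w\<close> is \<kappa> for both values of \<open>m\<close>. Taking
      \<open>w\<close> to be \<open>v\<close> identifies the remainder as
      \<open>S v\<close>.\<close>
    have *: "S w = c * KL_real \<Omega> w v + c * (\<kappa> + (LINT t|?M. uk t) - (LINT t|?M. v t))"
      if w: "w \<in> dom_entropy \<Omega>" "m = 1 \<longrightarrow> (LINT t|?M. w t) = 1" for w
    proof -
      have "w \<in> L1 \<Omega>" using w(1) by (simp add: dom_entropy_def)
      note l = ln_v[OF this]
      have k: "\<kappa> * (LINT t|?M. w t) = \<kappa>" using w(2) m by (auto simp: \<kappa>_def)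
      have "inner (A w) (yd - A uk) = - inner (A w) (A uk - yd)" by (simp add: inner_diff_right)
      then show ?thesis unfolding S_def KL_real_def l k using c by (simp add: field_simps)
    qed
    show ?thesis
      using *[OF w] *[OF dom_subdiff_entropy_subset[OF v]] v_norm by simp
  qed
  have u'D: "u' \<in> dom_entropy \<Omega>"
    and u'min: "\<And>w. w \<in> dom_entropy \<Omega> \<Longrightarrow> \<not> step_functional \<Omega> A c m yd uk w < step_functional \<Omega> A c m yd uk u'"
    using min unfolding is_arg_min_def by auto
  have vD: "v \<in> dom_entropy \<Omega>" using v by (rule dom_subdiff_entropy_subset)
  have fv: "step_functional \<Omega> A c m yd uk v = ereal (S v - inner yd (A uk - yd))"
    using step_functional_eq[OF vD uk(1) m] v_norm by (simp add: S_def inner_diff_left algebra_simps)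
  \<comment> \<open>A violated constraint would make the objective infinite at u', whereas
    \<open>v\<close> is feasible with a finite value.\<close>
  show u'1: "m = 1 \<longrightarrow> (LINT t|?M. u' t) = 1"
  proof (rule ccontr)
    assume "\<not> ?thesis"
    then have "step_functional \<Omega> A c m yd uk u' = \<infinity>"
      by (simp add: step_functional_def chi_def KL_def)
    then show False using u'min[OF vD] fv by simp
  qed
  have "step_functional \<Omega> A c m yd uk u' = ereal (S u' - inner yd (A uk - yd))"
    using step_functional_eq[OF u'D uk(1) m(1) u'1] by (simp add: S_def inner_diff_left algebra_simps)
  \<comment> \<open>By minimality against \<open>v\<close>, the identity \<open>S\<close> leaves no
    room for a positive divergence of u' from \<open>v\<close>.\<close>
  then have "c * KL_real \<Omega> u' v \<le> 0"
    using u'min[OF vD] fv S[OF u'D u'1] by simp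
  then have "KL_real \<Omega> u' v = 0"
    using KL_eq_KL_real(2)[OF u'D v] c by (simp add: mult_le_0_iff)
  then have u'v: "AE t in ?M. u' t = v t" by (rule KL_real_eq_0_imp_AE_eq[OF u'D v])
  have u'int: "integrable ?M u'" using u'D by (simp add: dom_entropy_iff)
  show u': "u' \<in> dom_subdiff_entropy \<Omega>"
    by (rule dom_subdiff_entropy_cong_AE[OF v u'int u'v])
  show "inner (A w) (A uk - yd) + c * KL_real \<Omega> w uk
      = c * KL_real \<Omega> w u' + (inner (A u') (A uk - yd) + c * KL_real \<Omega> u' uk)"
    if w: "w \<in> dom_entropy \<Omega>" "m = 1 \<longrightarrow> (LINT t|?M. w t) = 1" for w
  proof -
    have "integrable ?M w" using w by (simp add: dom_entropy_iff)
    then have "KL_real \<Omega> w v = KL_real \<Omega> w u'"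
      using u'v by (intro KL_real_cong_AE v u') auto
    then show ?thesis
      using S[OF w] S[OF u'D u'1] \<open>KL_real \<Omega> u' v = 0\<close> by (simp add: S_def)
  qed
  show "(LINT t|?M. x t * ln (u' t)) = (LINT t|?M. x t * ln (uk t)) + inner (A x) (yd - A uk) / c"
    if x: "x \<in> L1 \<Omega>" "m = 1 \<longrightarrow> (LINT t|?M. x t) = 0" for x
  proof -
    have x': "integrable ?M x" using x by (simp add: L1_def)
    have "(LINT t|?M. x t * ln (u' t)) = (LINT t|?M. x t * ln (v t))"
      using integrable_mult_ln[OF x' u'] integrable_mult_ln[OF x' v] u'v
      by (intro integral_cong_AE) (auto elim!: AE_mp)
    also have "\<kappa> * (LINT t|?M. x t) = 0" using x(2) m by (auto simp: \<kappa>_def)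
    ultimately show ?thesis using ln_v[OF x(1)] by simp
  qed
qed

section \<open>The iteration\<close>

lemma bounded_linear_L1_diff:
  fixes A :: "('a::euclidean_space \<Rightarrow> real) \<Rightarrow> 'b::real_normed_vector"
  assumes "bounded_linear_L1 \<Omega> A" "v \<in> L1 \<Omega>" "w \<in> L1 \<Omega>"
  shows "A (\<lambda>t. v t - w t) = A v - A w"
proof -
  define w' where "w' = (\<lambda>t. -1 * w t)"
  have "w' \<in> L1 \<Omega>" using assms(3) by (simp add: L1_def w'_def)
  then have "A (\<lambda>t. v t + w' t) = A v + A w'"
    using assms(1,2) unfolding bounded_linear_L1_def by blast
  also have "A w' = (-1) *\<^sub>R A w"
    using assms(1,3) unfolding bounded_linear_L1_def w'_def by blast
  finally show ?thesis by (simp add: w'_def)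
qed

text \<open>One fixed noise level and its data; the theorem instantiates this for every positive
  \<delta>.\<close>

locale entropic_iteration =
  fixes \<Omega> :: "'a::euclidean_space set"
    and A :: "('a \<Rightarrow> real) \<Rightarrow> 'y::real_inner"
    and m :: nat and c \<delta> :: real and yd :: 'y
    and z :: "'a \<Rightarrow> real" and u :: "nat \<Rightarrow> 'a \<Rightarrow> real"
  assumes \<Omega>: "\<Omega> \<in> lmeasurable"
    and A: "bounded_linear_L1 \<Omega> A"
    and m: "m \<in> {0, 1}"
    and c: "0 < c"
    and D_nonneg: "\<And>v w. v \<in> dom_entropy_chi \<Omega> m
      \<Longrightarrow> w \<in> dom_entropy_chi \<Omega> m \<inter> dom_subdiff_entropy \<Omega> \<Longrightarrow> 0 \<le> Dfun \<Omega> A c v w"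
    and z: "z \<in> dom_entropy_chi \<Omega> m"
    and noise: "norm (A z - yd) \<le> \<delta>"
    and \<delta>: "0 < \<delta>"
    and u_0: "u 0 \<in> dom_subdiff_entropy \<Omega>" "u 0 \<in> dom_entropy_chi \<Omega> m"
    and iter: "\<And>k. is_arg_min (step_functional \<Omega> A c m yd (u k)) (\<lambda>w. w \<in> dom_entropy \<Omega>) (u (Suc k))"
begin

definition D :: "('a \<Rightarrow> real) \<Rightarrow> ('a \<Rightarrow> real) \<Rightarrow> real" where
  "D w v = c * KL_real \<Omega> w v - 1/2 * (norm (A w - A v))\<^sup>2"

lemma iterate: "u k \<in> dom_subdiff_entropy \<Omega>" "u k \<in> dom_entropy_chi \<Omega> m"
proof -
  have "u k \<in> dom_subdiff_entropy \<Omega> \<and> u k \<in> dom_entropy_chi \<Omega> m"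
  proof (induction k)
    case (Suc k)
    then show ?case
      using entropic_step(1,2)[OF \<Omega> A m c _ _ iter[of k]] dom_subdiff_entropy_subset
      by (simp add: dom_entropy_chi_iff[OF m])
  qed (use u_0 in simp)
  then show "u k \<in> dom_subdiff_entropy \<Omega>" "u k \<in> dom_entropy_chi \<Omega> m" by auto
qed

lemma Dfun_iterate:
  assumes "w \<in> dom_entropy_chi \<Omega> m"
  shows "Dfun \<Omega> A c w (u k) = ereal (D w (u k))" and "0 \<le> D w (u k)"
proof -
  show *: "Dfun \<Omega> A c w (u k) = ereal (D w (u k))"
    using KL_eq_KL_real(1)[of w \<Omega> "u k"] assms iterate(1)[of k]
    by (simp add: Dfun_def D_def dom_entropy_chi_iff[OF m])
  show "0 \<le> D w (u k)"
    using D_nonneg[OF assms, of "u k"] iterate[of k] by (simp add: *)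
qed

text \<open>Each step minimizes with the residual term linearised at \<open>u k\<close>. Subtracting
  1/2 |A w - A v|^2 inside \<open>D\<close> is precisely what turns the linearised terms back into
  true squared residuals, by polarization.\<close>

lemma three_point:
  assumes "w \<in> dom_entropy_chi \<Omega> m"
  shows "1/2 * (norm (A (u (Suc k)) - yd))\<^sup>2 + D w (u (Suc k)) + D (u (Suc k)) (u k)
      + 1/2 * (norm (A w - A (u (Suc k))))\<^sup>2
    = 1/2 * (norm (A w - yd))\<^sup>2 + D w (u k)"
proof -
  let ?u = "u k" and ?v = "u (Suc k)"
  have "inner (A w) (A ?u - yd) + c * KL_real \<Omega> w ?u
      = c * KL_real \<Omega> w ?v + (inner (A ?v) (A ?u - yd) + c * KL_real \<Omega> ?v ?u)"
    using entropic_step(3)[OF \<Omega> A m c _ _ iter[of k], of w] assms iterate[of k]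
    by (simp add: dom_entropy_chi_iff[OF m])
  then show ?thesis
    unfolding D_def power2_norm_eq_inner
    by (simp add: inner_diff_left inner_diff_right inner_commute algebra_simps)
qed

lemma descent:
  "1/2 * (norm (A (u (Suc k)) - yd))\<^sup>2 + D z (u (Suc k)) + D (u (Suc k)) (u k) \<le> \<delta>\<^sup>2 / 2 + D z (u k)"
proof -
  have "(norm (A z - yd))\<^sup>2 \<le> \<delta>\<^sup>2" using noise by (intro power_mono) auto
  then show ?thesis using three_point[OF z, of k] zero_le_power2[of "norm (A z - A (u (Suc k)))"] by linarith
qed

text \<open>The three-point identity with \<open>u k\<close> itself as comparison element:
  \<open>D (u k) (u k)\<close> vanishes and all other extra terms are nonnegative.\<close>

lemma residual_decreasing: "decseq (\<lambda>k. norm (A (u k) - yd))"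
proof (rule decseq_SucI)
  fix k
  have "D (u k) (u k) = 0" by (simp add: D_def)
  then have "(norm (A (u (Suc k)) - yd))\<^sup>2 \<le> (norm (A (u k) - yd))\<^sup>2"
    using three_point[OF iterate(2)[of k], of k] Dfun_iterate(2)[OF iterate(2)[of k], of "Suc k"]
      Dfun_iterate(2)[OF iterate(2)[of "Suc k"], of k] zero_le_power2[of "norm (A (u k) - A (u (Suc k)))"]
    by linarith
  then show "norm (A (u (Suc k)) - yd) \<le> norm (A (u k) - yd)" by simp
qed

text \<open>Telescoped \<open>descent\<close>, multiplied by 2, with the nonnegative terms
  \<open>D (u (Suc k)) (u k)\<close> dropped.\<close>

lemma residual_sum:
  "(\<Sum>i<k. (norm (A (u (Suc i)) - yd))\<^sup>2) + 2 * D z (u k) \<le> real k * \<delta>\<^sup>2 + 2 * D z (u 0)"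
proof (induction k)
  case (Suc k)
  then show ?case
    using descent[of k] Dfun_iterate(2)[OF iterate(2), of "Suc k" k] by (simp add: algebra_simps)
qed simp

text \<open>By monotonicity the last residual is the smallest, so k times its square is below the
  sum.\<close>

lemma residual_bound:
  assumes "1 \<le> k"
  shows "(norm (A (u k) - yd))\<^sup>2 \<le> \<delta>\<^sup>2 + 2 * D z (u 0) / real k"
proof -
  have "real k * (norm (A (u k) - yd))\<^sup>2 = (\<Sum>i<k. (norm (A (u k) - yd))\<^sup>2)" by simp
  also have "\<dots> \<le> (\<Sum>i<k. (norm (A (u (Suc i)) - yd))\<^sup>2)"
    using residual_decreasing by (intro sum_mono power_mono) (auto simp: decseq_def)
  also have "\<dots> \<le> real k * \<delta>\<^sup>2 + 2 * D z (u 0)"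
    using residual_sum[of k] Dfun_iterate(2)[OF z, of k] by simp
  finally show ?thesis using assms by (simp add: field_simps)
qed

lemma D_strict_decrease:
  assumes "\<delta>\<^sup>2 < (norm (A (u (Suc k)) - yd))\<^sup>2"
  shows "D z (u (Suc k)) < D z (u k)"
  using descent[of k] Dfun_iterate(2)[OF iterate(2), of "Suc k" k] assms by simp

lemma stopping_set_nonempty:
  assumes "1 < \<tau>"
  shows "\<exists>k. norm (A (u k) - yd) < sqrt \<tau> * \<delta>"
proof -
  have "0 < (\<tau> - 1) * \<delta>\<^sup>2" using assms \<delta> by simp
  \<comment> \<open>Large enough that the excess in \<open>residual_bound\<close> falls below
    (\<tau> - 1) \<delta>^2; the index used is \<open>Suc n\<close>, since the bound starts at
    1.\<close>
  then obtain n where n: "2 * D z (u 0) / ((\<tau> - 1) * \<delta>\<^sup>2) < real n"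
    using reals_Archimedean2 by blast
  have "2 * D z (u 0) / real (Suc n) < (\<tau> - 1) * \<delta>\<^sup>2"
  proof -
    have "2 * D z (u 0) < real n * ((\<tau> - 1) * \<delta>\<^sup>2)"
      using n \<open>0 < (\<tau> - 1) * \<delta>\<^sup>2\<close> by (simp add: pos_divide_less_eq)
    also have "\<dots> \<le> real (Suc n) * ((\<tau> - 1) * \<delta>\<^sup>2)"
      using \<open>0 < (\<tau> - 1) * \<delta>\<^sup>2\<close> by (intro mult_right_mono) auto
    finally show ?thesis by (simp add: pos_divide_less_eq mult.commute)
  qed
  then have "(norm (A (u (Suc n)) - yd))\<^sup>2 < \<tau> * \<delta>\<^sup>2"
    using residual_bound[of "Suc n"] by (simp add: algebra_simps)
  also have "\<tau> * \<delta>\<^sup>2 = (sqrt \<tau> * \<delta>)\<^sup>2" using assms by (simp add: power_mult_distrib)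
  finally have "norm (A (u (Suc n)) - yd) < sqrt \<tau> * \<delta>"
    by (rule power2_less_imp_less) (use assms \<delta> in simp)
  then show ?thesis by blast
qed

text \<open>The source condition persists: up to an additive constant (when \<open>m = 1\<close>),
  \<open>1 + ln u\<^sub>k = A\<^sup>* w\<^sub>k\<close> with \<open>w\<^sub>k\<close> the initial source element plus the accumulated residuals.\<close>

lemma source_representation:
  assumes src: "adjoint_value \<Omega> A w (\<lambda>t. 1 + ln (u 0 t))"
    and x: "x \<in> L1 \<Omega>" "m = 1 \<longrightarrow> (LINT t|lebesgue_on \<Omega>. x t) = 0"
  shows "(LINT t|lebesgue_on \<Omega>. x t) + (LINT t|lebesgue_on \<Omega>. x t * ln (u k t))
    = inner (A x) (w + (1 / c) *\<^sub>R (\<Sum>j<k. yd - A (u j)))"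
proof (induction k)
  case 0
  have "integrable (lebesgue_on \<Omega>) x" using x by (simp add: L1_def)
  then have "(LINT t|lebesgue_on \<Omega>. x t) + (LINT t|lebesgue_on \<Omega>. x t * ln (u 0 t))
      = (LINT t|lebesgue_on \<Omega>. x t * (1 + ln (u 0 t)))"
    using integrable_mult_ln[OF _ iterate(1)[of 0]] by (simp add: distrib_left)
  then show ?case using src x(1) by (simp add: adjoint_value_def)
next
  case (Suc k)
  have "(LINT t|lebesgue_on \<Omega>. x t * ln (u (Suc k) t))
      = (LINT t|lebesgue_on \<Omega>. x t * ln (u k t)) + inner (A x) (yd - A (u k)) / c"
    using entropic_step(4)[OF \<Omega> A m c _ _ iter[of k] x] iterate[of k]
    by (simp add: dom_entropy_chi_iff[OF m])
  then show ?case using Suc.IH by (simp add: scaleR_add_right inner_add_right)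
qed

text \<open>The subgradient inequality of the entropy at \<open>u k\<close>, with subgradient 1 + ln
  u_k and slack KL(z, u_k) >= 0. The difference z - u_k has integral zero when m = 1, so the source
  representation applies to it.\<close>

lemma iterate_entropy_le:
  assumes src: "adjoint_value \<Omega> A w (\<lambda>t. 1 + ln (u 0 t))"
  shows "(LINT t|lebesgue_on \<Omega>. u k t * ln (u k t)) \<le> (LINT t|lebesgue_on \<Omega>. z t * ln (z t))
    - inner (A z - A (u k)) (w + (1 / c) *\<^sub>R (\<Sum>j<k. yd - A (u j)))"
proof -
  let ?M = "lebesgue_on \<Omega>"
  have zD: "z \<in> dom_entropy \<Omega>" using z by (simp add: dom_entropy_chi_iff[OF m])
  have i: "integrable ?M z" "integrable ?M (u k)"
    using zD dom_subdiff_entropy_integrable[OF iterate(1)] by (auto simp: dom_entropy_iff)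
  note il = integrable_mult_ln[OF i(1) iterate(1)[of k]] integrable_mult_ln[OF i(2) iterate(1)[of k]]
  define x where "x = (\<lambda>t. z t - u k t)"
  have "A x = A z - A (u k)"
    unfolding x_def by (rule bounded_linear_L1_diff[OF A]) (use i in \<open>auto simp: L1_def\<close>)
  moreover have "(LINT t|?M. x t) + (LINT t|?M. x t * ln (u k t))
      = inner (A x) (w + (1 / c) *\<^sub>R (\<Sum>j<k. yd - A (u j)))"
    using z iterate(2)[of k] i
    by (intro source_representation[OF src]) (auto simp: x_def L1_def dom_entropy_chi_iff[OF m])
  moreover have "(LINT t|?M. x t) = (LINT t|?M. z t) - (LINT t|?M. u k t)"
    unfolding x_def using i by simp
  moreover have "(LINT t|?M. x t * ln (u k t)) = (LINT t|?M. z t * ln (u k t)) - (LINT t|?M. u k t * ln (u k t))"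
    unfolding x_def using il by (simp add: left_diff_distrib)
  ultimately show ?thesis
    using KL_eq_KL_real(2)[OF zD iterate(1)[of k]] by (simp add: KL_real_def)
qed

text \<open>The sum of the residuals before stopping grows at most like \<open>1 / \<delta>\<close>, whereas the residual
  at the stopping index is of order \<open>\<delta>\<close>, so that their product stays bounded.\<close>

lemma stopped_entropy_le:
  assumes src: "adjoint_value \<Omega> A w (\<lambda>t. 1 + ln (u 0 t))"
    and \<tau>: "1 < \<tau>" and \<delta>1: "\<delta> \<le> 1"
    and k: "norm (A (u k) - yd) < sqrt \<tau> * \<delta>"
    and less: "\<And>j. j < k \<Longrightarrow> sqrt \<tau> * \<delta> \<le> norm (A (u j) - yd)"
  shows "(LINT t|lebesgue_on \<Omega>. u k t * ln (u k t)) \<le> (LINT t|lebesgue_on \<Omega>. z t * ln (z t))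
    + (1 + sqrt \<tau>) * (norm w + (norm (A (u 0) - A z) + 1 + 2 * D z (u 0) / (\<tau> - 1) + 2 * D z (u 0)) / c)"
proof -
  let ?r = "\<lambda>j. norm (A (u j) - yd)" and ?W = "w + (1 / c) *\<^sub>R (\<Sum>j<k. yd - A (u j))"
  have D0: "0 \<le> D z (u 0)" by (rule Dfun_iterate(2)[OF z])
  \<comment> \<open>Turns out to bound n \<delta>^2 when the stopping index is n + 1.\<close>
  define P where "P = 2 * D z (u 0) / (\<tau> - 1)"
  have P: "0 \<le> P" using D0 \<tau> by (simp add: P_def)
  have r0: "?r 0 \<le> norm (A (u 0) - A z) + \<delta>"
    using norm_triangle_ineq[of "A (u 0) - A z" "A z - yd"] noise by simp
  have sum: "\<delta> * (\<Sum>j<k. ?r j) \<le> norm (A (u 0) - A z) + 1 + P + 2 * D z (u 0)"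
  proof (cases k)
    case 0
    then show ?thesis using D0 P by simp
  next
    case (Suc n)
    \<comment> \<open>The residual at index 0 is set apart because \<open>residual_sum\<close>
      starts at index 1. The indices 1 to n all precede stopping.\<close>
    have r: "sqrt \<tau> * \<delta> \<le> ?r (Suc i)" if "i < n" for i using less[of "Suc i"] that Suc by simp
    have s1: "1 \<le> sqrt \<tau>" using \<tau> by simp
    have \<delta>r: "\<delta> \<le> ?r (Suc i)" if "i < n" for i
      using r[OF that] mult_right_mono[OF s1 less_imp_le[OF \<delta>]] by linarith
    \<comment> \<open>Each of these n squared residuals is at least \<tau> \<delta>^2, while
      \<open>residual_sum\<close> allows \<delta>^2 per step plus a constant; the surplus limits
      n.\<close>
    have "real n * (\<tau> * \<delta>\<^sup>2) = (\<Sum>i<n. (sqrt \<tau> * \<delta>)\<^sup>2)"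
      using \<tau> by (simp add: power_mult_distrib)
    also have "\<dots> \<le> (\<Sum>i<n. (?r (Suc i))\<^sup>2)"
      using r \<tau> \<delta> by (intro sum_mono power_mono) auto
    also have S: "\<dots> \<le> real n * \<delta>\<^sup>2 + 2 * D z (u 0)"
      using residual_sum[of n] Dfun_iterate(2)[OF z, of n] by simp
    finally have "(\<tau> - 1) * (real n * \<delta>\<^sup>2) \<le> 2 * D z (u 0)" by (simp add: algebra_simps)
    then have nP: "real n * \<delta>\<^sup>2 \<le> P" using \<tau> by (simp add: P_def pos_le_divide_eq mult.commute)
    \<comment> \<open>Before stopping \<delta> is at most the residual, so \<delta> times a residual
      is at most its square.\<close>
    have "\<delta> * (\<Sum>i<n. ?r (Suc i)) = (\<Sum>i<n. \<delta> * ?r (Suc i))" by (rule sum_distrib_left)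
    also have "\<dots> \<le> (\<Sum>i<n. (?r (Suc i))\<^sup>2)"
      unfolding power2_eq_square using \<delta>r by (intro sum_mono mult_right_mono) auto
    finally have "\<delta> * (\<Sum>i<n. ?r (Suc i)) \<le> P + 2 * D z (u 0)" using S nP by linarith
    moreover have "\<delta> * ?r 0 \<le> norm (A (u 0) - A z) + 1"
    proof -
      have "\<delta> * ?r 0 \<le> 1 * ?r 0" using \<delta>1 by (intro mult_right_mono) auto
      then show ?thesis using r0 \<delta>1 by linarith
    qed
    ultimately show ?thesis unfolding Suc sum.lessThan_Suc_shift distrib_left by linarith
  qed
  have "norm ?W \<le> norm w + (1 / c) * (\<Sum>j<k. ?r j)"
  proof -
    have "norm (\<Sum>j<k. yd - A (u j)) \<le> (\<Sum>j<k. ?r j)"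
      by (rule order_trans[OF norm_sum]) (simp add: norm_minus_commute)
    then have "norm ((1 / c) *\<^sub>R (\<Sum>j<k. yd - A (u j))) \<le> (1 / c) * (\<Sum>j<k. ?r j)"
      using c by (simp add: divide_right_mono)
    then show ?thesis using norm_triangle_ineq[of w "(1 / c) *\<^sub>R (\<Sum>j<k. yd - A (u j))"] by linarith
  qed
  then have "\<delta> * norm ?W \<le> \<delta> * (norm w + (1 / c) * (\<Sum>j<k. ?r j))"
    using \<delta> by (intro mult_left_mono) auto
  also have "\<dots> = \<delta> * norm w + (1 / c) * (\<delta> * (\<Sum>j<k. ?r j))"
    by (simp add: distrib_left)
  also have "\<dots> \<le> norm w + (1 / c) * (norm (A (u 0) - A z) + 1 + P + 2 * D z (u 0))"
    using sum c mult_right_mono[OF \<delta>1, of "norm w"] by (intro add_mono mult_left_mono) auto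
  finally have W: "\<delta> * norm ?W \<le> norm w + (norm (A (u 0) - A z) + 1 + P + 2 * D z (u 0)) / c"
    by simp
  have "norm (A z - A (u k)) \<le> (1 + sqrt \<tau>) * \<delta>"
    using norm_triangle_ineq4[of "A z - yd" "A (u k) - yd"] noise k by (simp add: algebra_simps)
  then have "norm (A z - A (u k)) * norm ?W \<le> ((1 + sqrt \<tau>) * \<delta>) * norm ?W"
    by (rule mult_right_mono) simp
  also have "\<dots> \<le> (1 + sqrt \<tau>) * (norm w + (norm (A (u 0) - A z) + 1 + P + 2 * D z (u 0)) / c)"
    unfolding mult.assoc using W \<tau> by (intro mult_left_mono) auto
  finally have "- inner (A z - A (u k)) ?W
      \<le> (1 + sqrt \<tau>) * (norm w + (norm (A (u 0) - A z) + 1 + P + 2 * D z (u 0)) / c)"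
    using Cauchy_Schwarz_ineq2[of "A z - A (u k)" ?W] by linarith
  then show ?thesis using iterate_entropy_le[OF src, of k] unfolding P_def by linarith
qed

end

section \<open>Convergence\<close>

text \<open>The functionals u -> <A u, h> are bounded, so the images converge weakly to
  \<open>A v\<close>; testing with all \<open>h\<close> makes the two limits agree.\<close>

lemma weak_limit_image:
  fixes A :: "('a::euclidean_space \<Rightarrow> real) \<Rightarrow> 'y::real_inner"
  assumes A: "bounded_linear_L1 \<Omega> A" and w: "weakly_converges_L1 \<Omega> x v"
    and lim: "(\<lambda>n. A (x n)) \<longlonglongrightarrow> y"
  shows "A v = y"
proof -
  have "inner (A v) h = inner y h" for h
  proof (rule LIMSEQ_unique)
    show "(\<lambda>n. inner (A (x n)) h) \<longlonglongrightarrow> inner (A v) h"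
      using w bounded_linear_L1_inner[OF A, of h] by (auto simp: weakly_converges_L1_def)
    show "(\<lambda>n. inner (A (x n)) h) \<longlonglongrightarrow> inner y h"
      by (intro tendsto_intros lim)
  qed
  then show ?thesis by (metis inner_commute vector_eq_ldot)
qed

text \<open>Every bounded functional is integration against a bounded function, so the preceding
  compactness result reaches the whole dual.\<close>

lemma entropy_bounded_weakly_converges_subsequence:
  fixes \<Omega> :: "'a::euclidean_space set" and x :: "nat \<Rightarrow> 'a \<Rightarrow> real"
  assumes \<Omega>: "\<Omega> \<in> lmeasurable" and x: "\<And>n. x n \<in> dom_entropy \<Omega>"
    and B: "\<And>n. (LINT t|lebesgue_on \<Omega>. x n t * ln (x n t)) \<le> B"
  obtains r v where "strict_mono r" "weakly_converges_L1 \<Omega> (\<lambda>n. x (r n)) v"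
proof -
  have x': "integrable (lebesgue_on \<Omega>) (x n)" "AE t in lebesgue_on \<Omega>. 0 \<le> x n t"
    "integrable (lebesgue_on \<Omega>) (\<lambda>t. x n t * ln (x n t))" for n
    using x[of n] by (simp_all add: dom_entropy_iff)
  obtain r v where r: "strict_mono r" "integrable (lebesgue_on \<Omega>) v"
    "\<And>g C. g \<in> borel_measurable (lebesgue_on \<Omega>) \<Longrightarrow> AE t in lebesgue_on \<Omega>. \<bar>g t\<bar> \<le> C \<Longrightarrow>
      (\<lambda>n. LINT t|lebesgue_on \<Omega>. x (r n) t * g t) \<longlonglongrightarrow> (LINT t|lebesgue_on \<Omega>. v t * g t)"
    by (rule entropy_bounded_weak_subsequence[OF \<Omega> x' B]) (rule that)
  have xL: "x n \<in> L1 \<Omega>" for n using x by (simp add: dom_entropy_def)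
  have vL: "v \<in> L1 \<Omega>" using r(2) by (simp add: L1_def)
  have "(\<lambda>n. \<phi> (x (r n))) \<longlonglongrightarrow> \<phi> v" if \<phi>: "bounded_linear_L1 \<Omega> \<phi>" for \<phi> :: "('a \<Rightarrow> real) \<Rightarrow> real"
  proof -
    obtain g C where g: "g \<in> borel_measurable (lebesgue_on \<Omega>)" "AE t in lebesgue_on \<Omega>. \<bar>g t\<bar> \<le> C"
      "\<And>u. u \<in> L1 \<Omega> \<Longrightarrow> \<phi> u = (LINT t|lebesgue_on \<Omega>. u t * g t)"
      by (rule bounded_linear_L1_repr[OF \<Omega> \<phi>]) (rule that)
    show ?thesis unfolding g(3)[OF xL] g(3)[OF vL] by (rule r(3)[OF g(1,2)])
  qed
  then show ?thesis using that r(1) xL vL by (auto simp: weakly_converges_L1_def)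
qed

theorem proposition3p3:
  fixes \<Omega> :: "'a::euclidean_space set"
    and A :: "('a \<Rightarrow> real) \<Rightarrow> 'y::{real_inner,complete_space}"
    and y :: 'y
    and yd :: "real \<Rightarrow> 'y"
    and m :: nat
    and c \<gamma> :: real
    and z u0 :: "'a \<Rightarrow> real"
    and u :: "real \<Rightarrow> nat \<Rightarrow> 'a \<Rightarrow> real"
  assumes Omega: "open \<Omega>" "bounded \<Omega>"
    and m: "m \<in> {0, 1}"
    and c: "0 < c"
    and A: "bounded_linear_L1 \<Omega> A"
    and gamma: "0 < \<gamma>"
    and A_KL: "\<And>v w. v \<in> dom_entropy_chi \<Omega> m \<Longrightarrow> w \<in> dom_entropy_chi \<Omega> m \<Longrightarrow> KL \<Omega> v w < \<infinity>
      \<Longrightarrow> norm (A v - A w) \<le> \<gamma> * sqrt (real_of_ereal (KL \<Omega> v w))"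
    and D_nonneg: "\<And>v w. v \<in> dom_entropy_chi \<Omega> m
      \<Longrightarrow> w \<in> dom_entropy_chi \<Omega> m \<inter> dom_subdiff_entropy \<Omega> \<Longrightarrow> 0 \<le> Dfun \<Omega> A c v w"
    and z: "z \<in> dom_entropy \<Omega>" "AE t in lebesgue_on \<Omega>. 0 < z t" "A z = y" "m = 1 \<Longrightarrow> chi \<Omega> m z = 0"
    and noise: "\<And>\<delta>. 0 < \<delta> \<Longrightarrow> norm (y - yd \<delta>) \<le> \<delta>"
    and u0: "u0 \<in> dom_subdiff_entropy \<Omega>" "(\<lambda>t. 1 + ln (u0 t)) \<in> range_adjoint \<Omega> A"
      "m = 1 \<Longrightarrow> chi \<Omega> m u0 = 0"
    and start: "\<And>\<delta>. 0 < \<delta> \<Longrightarrow> u \<delta> 0 = u0"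
    and iter: "\<And>\<delta> k. 0 < \<delta> \<Longrightarrow>
      is_arg_min (step_functional \<Omega> A c m (yd \<delta>) (u \<delta> k)) (\<lambda>w. w \<in> dom_entropy \<Omega>) (u \<delta> (Suc k))"
  shows
    "(\<forall>\<delta>>0. decseq (\<lambda>k. norm (A (u \<delta> k) - yd \<delta>)) \<and>
        (\<forall>k. ereal (1/2 * (norm (yd \<delta> - A (u \<delta> (Suc k))))\<^sup>2) + Dfun \<Omega> A c z (u \<delta> (Suc k))
              + Dfun \<Omega> A c (u \<delta> (Suc k)) (u \<delta> k)
            \<le> ereal (\<delta>\<^sup>2 / 2) + Dfun \<Omega> A c z (u \<delta> k)) \<and>
        (\<forall>k\<ge>1. ereal ((norm (yd \<delta> - A (u \<delta> k)))\<^sup>2)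
            \<le> ereal (\<delta>\<^sup>2) + 2 * Dfun \<Omega> A c z u0 / ereal (real k))) \<and>
     (\<forall>\<delta>>0. \<forall>k\<ge>1. (norm (yd \<delta> - A (u \<delta> k)))\<^sup>2 > \<delta>\<^sup>2 \<longrightarrow>
        Dfun \<Omega> A c z (u \<delta> k) < Dfun \<Omega> A c z (u \<delta> (k - 1))) \<and>
     (\<forall>\<tau>>1. \<forall>\<delta>>0. {k. norm (A (u \<delta> k) - yd \<delta>) < sqrt \<tau> * \<delta>} \<noteq> {}) \<and>
     (\<forall>\<tau>>1. let k\<^sub>s = (\<lambda>\<delta>. stopping_index A \<tau> \<delta> (yd \<delta>) (u \<delta>)) in
        (\<exists>\<delta>s v. (\<forall>n. 0 < \<delta>s n) \<and> \<delta>s \<longlonglongrightarrow> 0 \<and>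
           weakly_converges_L1 \<Omega> (\<lambda>n. u (\<delta>s n) (k\<^sub>s (\<delta>s n))) v) \<and>
        (\<not> bdd_above (k\<^sub>s ` {0<..}) \<longrightarrow>
           (\<forall>\<delta>s v. (\<forall>n. 0 < \<delta>s n) \<and> \<delta>s \<longlonglongrightarrow> 0 \<and>
              weakly_converges_L1 \<Omega> (\<lambda>n. u (\<delta>s n) (k\<^sub>s (\<delta>s n))) v \<longrightarrow> A v = y)))"
proof -
  have \<Omega>: "\<Omega> \<in> lmeasurable"
    using Omega by (simp add: lmeasurable_open)
  have zc: "z \<in> dom_entropy_chi \<Omega> m"
    using z(1,4) by (auto simp: dom_entropy_chi_iff[OF m] chi_def split: if_splits)
  have u0c: "u0 \<in> dom_entropy_chi \<Omega> m"
    using dom_subdiff_entropy_subset[OF u0(1)] u0(3)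
    by (auto simp: dom_entropy_chi_iff[OF m] chi_def split: if_splits)
  have it: "entropic_iteration \<Omega> A m c \<delta> (yd \<delta>) z (u \<delta>)" if "0 < \<delta>" for \<delta>
  proof
    show "norm (A z - yd \<delta>) \<le> \<delta>" using noise[OF that] z(3) by simp
    show "u \<delta> 0 \<in> dom_subdiff_entropy \<Omega>" "u \<delta> 0 \<in> dom_entropy_chi \<Omega> m"
      using u0(1) u0c start[OF that] by simp_all
  qed (fact that \<Omega> A m c D_nonneg zc iter[OF that])+
  define D where "D = entropic_iteration.D \<Omega> A c"
  have Dz: "Dfun \<Omega> A c z (u \<delta> k) = ereal (D z (u \<delta> k))" if "0 < \<delta>" for \<delta> k
    using entropic_iteration.Dfun_iterate(1)[OF it[OF that] zc] by (simp add: D_def)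
  have Du: "Dfun \<Omega> A c (u \<delta> j) (u \<delta> k) = ereal (D (u \<delta> j) (u \<delta> k))" if "0 < \<delta>" for \<delta> j k
    using entropic_iteration.Dfun_iterate(1)[OF it[OF that] entropic_iteration.iterate(2)[OF it[OF that]]]
    by (simp add: D_def)
  \<comment> \<open>A statement about \<open>u0\<close> alone, read off from the start of the
    iteration at noise level 1.\<close>
  have D0: "Dfun \<Omega> A c z u0 = ereal (D z u0)"
    using Dz[of 1 0] start[of 1] by simp
  have claim_i: "decseq (\<lambda>k. norm (A (u \<delta> k) - yd \<delta>))"
    "ereal (1/2 * (norm (yd \<delta> - A (u \<delta> (Suc k))))\<^sup>2) + Dfun \<Omega> A c z (u \<delta> (Suc k))
        + Dfun \<Omega> A c (u \<delta> (Suc k)) (u \<delta> k)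
      \<le> ereal (\<delta>\<^sup>2 / 2) + Dfun \<Omega> A c z (u \<delta> k)"
    "1 \<le> k \<Longrightarrow> ereal ((norm (yd \<delta> - A (u \<delta> k)))\<^sup>2) \<le> ereal (\<delta>\<^sup>2) + 2 * Dfun \<Omega> A c z u0 / ereal (real k)"
    if \<delta>: "0 < \<delta>" for \<delta> k
  proof -
    show "decseq (\<lambda>k. norm (A (u \<delta> k) - yd \<delta>))"
      by (rule entropic_iteration.residual_decreasing[OF it[OF \<delta>]])
    show "ereal (1/2 * (norm (yd \<delta> - A (u \<delta> (Suc k))))\<^sup>2) + Dfun \<Omega> A c z (u \<delta> (Suc k))
        + Dfun \<Omega> A c (u \<delta> (Suc k)) (u \<delta> k)
      \<le> ereal (\<delta>\<^sup>2 / 2) + Dfun \<Omega> A c z (u \<delta> k)"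
      using entropic_iteration.descent[OF it[OF \<delta>], of k]
      by (simp add: Dz[OF \<delta>] Du[OF \<delta>] D_def norm_minus_commute)
    show "ereal ((norm (yd \<delta> - A (u \<delta> k)))\<^sup>2) \<le> ereal (\<delta>\<^sup>2) + 2 * Dfun \<Omega> A c z u0 / ereal (real k)"
      if "1 \<le> k"
    proof -
      have "2 * Dfun \<Omega> A c z u0 = ereal (2 * D z u0)"
        unfolding D0 by (metis numeral_eq_ereal times_ereal.simps(1))
      then have "2 * Dfun \<Omega> A c z u0 / ereal (real k) = ereal (2 * D z u0 / real k)"
        using that by simp
      then show ?thesis
        using entropic_iteration.residual_bound[OF it[OF \<delta>] that] start[OF \<delta>]
        by (simp add: D_def norm_minus_commute)
    qed
  qed
  have claim_ii: "Dfun \<Omega> A c z (u \<delta> k) < Dfun \<Omega> A c z (u \<delta> (k - 1))"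
    if \<delta>: "0 < \<delta>" and k: "1 \<le> k" "(norm (yd \<delta> - A (u \<delta> k)))\<^sup>2 > \<delta>\<^sup>2" for \<delta> k
  proof -
    obtain j where j: "k = Suc j" using k(1) by (cases k) auto
    show ?thesis
      using entropic_iteration.D_strict_decrease[OF it[OF \<delta>], of j] k(2)
      by (simp add: j Dz[OF \<delta>] D_def norm_minus_commute)
  qed
  have claim_iii: "\<exists>k. norm (A (u \<delta> k) - yd \<delta>) < sqrt \<tau> * \<delta>" if "1 < \<tau>" "0 < \<delta>" for \<tau> \<delta>
    by (rule entropic_iteration.stopping_set_nonempty[OF it[OF that(2)] that(1)])
  have stop: "norm (A (u \<delta> (stopping_index A \<tau> \<delta> (yd \<delta>) (u \<delta>))) - yd \<delta>) < sqrt \<tau> * \<delta>"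
    if "1 < \<tau>" "0 < \<delta>" for \<tau> \<delta>
    unfolding stopping_index_def using claim_iii[OF that] by (rule LeastI_ex)
  obtain w where src: "adjoint_value \<Omega> A w (\<lambda>t. 1 + ln (u0 t))"
    using u0(2) by (auto simp: range_adjoint_def)
  have subsequence: "\<exists>\<delta>s v. (\<forall>n. 0 < \<delta>s n) \<and> \<delta>s \<longlonglongrightarrow> 0 \<and>
      weakly_converges_L1 \<Omega> (\<lambda>n. u (\<delta>s n) (stopping_index A \<tau> (\<delta>s n) (yd (\<delta>s n)) (u (\<delta>s n)))) v"
    if \<tau>: "1 < \<tau>" for \<tau>
  proof -
    define \<delta>s where "\<delta>s n = 1 / real (Suc n)" for n
    define x where "x \<delta> = u \<delta> (stopping_index A \<tau> \<delta> (yd \<delta>) (u \<delta>))" for \<delta>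
    have \<delta>s: "0 < \<delta>s n" "\<delta>s n \<le> 1" for n by (auto simp: \<delta>s_def)
    have lim: "\<delta>s \<longlonglongrightarrow> 0"
      unfolding \<delta>s_def[abs_def] using LIMSEQ_inverse_real_of_nat by (simp add: inverse_eq_divide)
    \<comment> \<open>The bound is independent of \<open>n\<close>: \<open>u0\<close>, its source
      element \<open>w\<close>, \<open>z\<close> and \<tau> are the same for all noise
      levels.\<close>
    have ent: "(LINT t|lebesgue_on \<Omega>. x (\<delta>s n) t * ln (x (\<delta>s n) t)) \<le> (LINT t|lebesgue_on \<Omega>. z t * ln (z t))
      + (1 + sqrt \<tau>) * (norm w + (norm (A u0 - A z) + 1 + 2 * D z u0 / (\<tau> - 1) + 2 * D z u0) / c)" for n
    proof -
      let ?k = "stopping_index A \<tau> (\<delta>s n) (yd (\<delta>s n)) (u (\<delta>s n))"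
      interpret E: entropic_iteration \<Omega> A m c "\<delta>s n" "yd (\<delta>s n)" z "u (\<delta>s n)"
        by (rule it[OF \<delta>s(1)])
      have src': "adjoint_value \<Omega> A w (\<lambda>t. 1 + ln (u (\<delta>s n) 0 t))"
        using src start[OF \<delta>s(1)[of n]] by simp
      \<comment> \<open>Minimality of the stopping index is what bounds the earlier residuals from
        below.\<close>
      have less: "sqrt \<tau> * \<delta>s n \<le> norm (A (u (\<delta>s n) j) - yd (\<delta>s n))" if "j < ?k" for j
        using not_less_Least[OF that[unfolded stopping_index_def]] by simp
      have "(LINT t|lebesgue_on \<Omega>. u (\<delta>s n) ?k t * ln (u (\<delta>s n) ?k t)) \<le> (LINT t|lebesgue_on \<Omega>. z t * ln (z t))
        + (1 + sqrt \<tau>) * (norm w + (norm (A (u (\<delta>s n) 0) - A z) + 1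
          + 2 * E.D z (u (\<delta>s n) 0) / (\<tau> - 1) + 2 * E.D z (u (\<delta>s n) 0)) / c)"
        by (rule E.stopped_entropy_le[OF src' \<tau> \<delta>s(2) stop[OF \<tau> \<delta>s(1)]]) (rule less)
      then show ?thesis
        by (simp only: x_def D_def start[OF \<delta>s(1)[of n]])
    qed
    have dom: "x (\<delta>s n) \<in> dom_entropy \<Omega>" for n
      unfolding x_def using entropic_iteration.iterate(1)[OF it[OF \<delta>s(1)]] by (rule dom_subdiff_entropy_subset)
    obtain r v where r: "strict_mono r" "weakly_converges_L1 \<Omega> (\<lambda>n. x (\<delta>s (r n))) v"
      by (rule entropy_bounded_weakly_converges_subsequence[OF \<Omega>, of "\<lambda>n. x (\<delta>s n)", OF dom ent]) (rule that)
    have "(\<lambda>n. \<delta>s (r n)) \<longlonglongrightarrow> 0" using LIMSEQ_subseq_LIMSEQ[OF lim r(1)] by (simp add: o_def)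
    then show ?thesis
      using r(2) \<delta>s(1) by (intro exI[of _ "\<lambda>n. \<delta>s (r n)"] exI[of _ v]) (simp add: x_def)
  qed
  have limit_point: "A v = y"
    if \<tau>: "1 < \<tau>" and \<delta>s: "\<forall>n. 0 < \<delta>s n" "\<delta>s \<longlonglongrightarrow> 0"
      and v: "weakly_converges_L1 \<Omega> (\<lambda>n. u (\<delta>s n) (stopping_index A \<tau> (\<delta>s n) (yd (\<delta>s n)) (u (\<delta>s n)))) v"
    for \<tau> \<delta>s v
  proof (rule weak_limit_image[OF A v])
    let ?x = "\<lambda>n. u (\<delta>s n) (stopping_index A \<tau> (\<delta>s n) (yd (\<delta>s n)) (u (\<delta>s n)))"
    \<comment> \<open>The stopping rule contributes sqrt \<tau> times the noise level and the data
      error at most one further noise level.\<close>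
    have "norm (A (?x n) - y) \<le> (sqrt \<tau> + 1) * \<delta>s n" for n
    proof -
      have \<delta>n: "0 < \<delta>s n" using \<delta>s(1) by simp
      have "norm (A (?x n) - y) = norm ((A (?x n) - yd (\<delta>s n)) - (y - yd (\<delta>s n)))" by simp
      also have "\<dots> \<le> norm (A (?x n) - yd (\<delta>s n)) + norm (y - yd (\<delta>s n))"
        by (rule norm_triangle_ineq4)
      also have "\<dots> \<le> sqrt \<tau> * \<delta>s n + \<delta>s n"
        by (intro add_mono less_imp_le[OF stop[OF \<tau> \<delta>n]] noise[OF \<delta>n])
      finally show ?thesis by (simp add: distrib_right)
    qed
    then have "(\<lambda>n. A (?x n) - y) \<longlonglongrightarrow> 0"
      by (rule Lim_null_comparison[OF always_eventually[OF allI] tendsto_mult_right_zero[OF \<delta>s(2)]])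
    then show "(\<lambda>n. A (?x n)) \<longlonglongrightarrow> y" by (simp add: LIM_zero_iff)
  qed
  show ?thesis
    unfolding Let_def
  proof (intro conjI allI impI)
    show "{k. norm (A (u \<delta> k) - yd \<delta>) < sqrt \<tau> * \<delta>} \<noteq> {}" if "1 < \<tau>" "0 < \<delta>" for \<tau> \<delta>
      using claim_iii[OF that] by simp
    show "A v = y"
      if "1 < \<tau>" and "(\<forall>n. 0 < \<delta>s n) \<and> \<delta>s \<longlonglongrightarrow> 0 \<and>
        weakly_converges_L1 \<Omega> (\<lambda>n. u (\<delta>s n) (stopping_index A \<tau> (\<delta>s n) (yd (\<delta>s n)) (u (\<delta>s n)))) v"
      for \<tau> \<delta>s v
      using that(2) by (elim conjE) (rule limit_point[OF that(1)])
  qed (fact claim_i claim_ii subsequence)+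
qed

end
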